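(* Let $\mathcal{O}$ be a Euclidean oriented matroid on the ground set $E$, and let $\mathcal{O}\cup p=\mathcal{O}[e_1^{\alpha_1},\dots,e_k^{\alpha_k}]$ be a lexicographic extension of $\mathcal{O}$ in which $p$ is not a loop. Let $f\in E$ be an element that is not a coloop of $\mathcal{O}\cup p$. Then the oriented matroid program $(\mathcal{O}\cup p,p,f)$ is Euclidean.
   Context: Let $\mathcal{O}$ be an oriented matroid of rank $r$ on a finite ground set $E$, given by its set of cocircuits (sign vectors in $\{+,-,0\}^E$). For sign vectors $X,Y$: $\operatorname{supp}(X)=\{e:X_e\neq 0\}$, $z(X)=E\setminus\operatorname{supp}(X)$, $\operatorname{sep}(X,Y)=\{e: X_e=-Y_e\neq 0\}$, $(X\circ Y)_e=X_e$ if $X_e\neq 0$ and $(X\circ Y)_e=Y_e$ otherwise; $X,Y$ are conformal if $\operatorname{sep}(X,Y)=\emptyset$. $\mathcal{M}(\mathcal{O})$ is the underlying matroid. An edge is a covector $F$ whose zero set $z(F)$ is a flat of rank $r-2$ of $\mathcal{M}(\mathcal{O})$. Two cocircuits $X\neq\pm Y$ are comodular if $X\circ Y$ is an edge. For comodular cocircuits $X,Y$ and $e\in\operatorname{sep}(X,Y)$ there is a unique cocircuit $Z$ with $Z_e=0$ and $Z_h=(X\circ Y)_h$ for all $h\notin\operatorname{sep}(X,Y)$ ("cocircuit elimination of $e$ between $X$ and $Y$"). An oriented matroid program is a triple $(\mathcal{O},g,f)$ with $g\neq f\in E$, $g$ not a loop, $f$ not a coloop. For comodular cocircuits $X,Y$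 with $X_g=Y_g\neq 0$ let $Z$ be obtained by eliminating $g$ between $-X$ and $Y$; write $X\to_{g,f}Y$ if $Z_f=+$, $X\leftarrow_{g,f}Y$ if $Z_f=-$, and $X\leftrightarrow_{g,f}Y$ (undirected) if $Z_f=0$. The cocircuit graph $G_f$ of $(\mathcal{O},g,f)$ has as vertices the cocircuits $X$ with $X_g=+$ and as edges the pairs $\{X,Y\}$ of conformal comodular such cocircuits, oriented as just described. A directed cycle in $G_f$ is a sequence $P^1,\dots,P^n=P^1$ of vertices with $P^1,\dots,P^{n-1}$ pairwise distinct, $\{P^i,P^{i+1}\}$ an edge, $P^i\to P^{i+1}$ or $P^i\leftrightarrow P^{i+1}$ for all $i$, and $P^i\to P^{i+1}$ for at least one $i$. The program is Euclidean if $G_f$ has no directed cycle. An oriented matroid $\mathcal{O}$ is Euclidean if every oriented matroid program $(\mathcal{O},g,f)$ is Euclidean. A single-element extension $\mathcal{O}\cup p$ is determined by a localization $\sigma$ (a map from cocircuits of $\mathcal{O}$ to $\{+,-,0\}$); its cocircuits are the old cocircuits $(Y,\sigma(Y))$, $Y$ a cocircuit of $\mathcal{O}$, and the new cocircuits $(Y^1\circ Y^2,0)$ with $Y^1,Y^2$ conformal comodular cocircuits of $\mathcal{O}$ with $\sigma(Y^1)=-\sigma(Y^2)\neq 0$. For an ordered subset $I=[e_1,\dots,e_k]$ of $E$, the index of a cocircuit $Y$ with respect to $I$ is the smallest $i$ with $Y_{e_i}\neq 0$, or $k+1$ if there is none. For $\alpha\in\{+,-\}^k$, the lexicographic extension $\mathcal{O}[e_1^{\alpha_1},\dots,e_k^{\alpha_k}]=\mathcal{O}\cup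 p$ is the single-element extension with localization $\sigma(Y)=\alpha_iY_{e_i}$ if the index $i$ of $Y$ is $\le k$, and $\sigma(Y)=0$ otherwise. *)

theory Defs
  imports Main
begin

datatype sign = Pos | Neg | Zer

type_synonym 'a signvec = "'a \<Rightarrow> sign"

fun sneg :: "sign \<Rightarrow> sign" where
  "sneg Pos = Neg" | "sneg Neg = Pos" | "sneg Zer = Zer"

fun smult :: "sign \<Rightarrow> sign \<Rightarrow> sign" where
  "smult Zer _ = Zer" | "smult _ Zer = Zer"
| "smult Pos s = s" | "smult Neg s = sneg s"

definition zerovec :: "'a signvec" where "zerovec = (\<lambda>_. Zer)"

definition vneg :: "'a signvec \<Rightarrow> 'a signvec" where
  "vneg X = (\<lambda>e. sneg (X e))"

definition supp :: "'a signvec \<Rightarrow> 'a set" where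
  "supp X = {e. X e \<noteq> Zer}"

definition zset :: "'a set \<Rightarrow> 'a signvec \<Rightarrow> 'a set" where
  "zset E X = {e \<in> E. X e = Zer}"

definition sep :: "'a signvec \<Rightarrow> 'a signvec \<Rightarrow> 'a set" where
  "sep X Y = {e. X e \<noteq> Zer \<and> X e = sneg (Y e)}"

definition comp :: "'a signvec \<Rightarrow> 'a signvec \<Rightarrow> 'a signvec" where
  "comp X Y = (\<lambda>e. if X e \<noteq> Zer then X e else Y e)"

definition conformal :: "'a signvec \<Rightarrow> 'a signvec \<Rightarrow> bool" where
  "conformal X Y \<longleftrightarrow> sep X Y = {}"

section \<open>Oriented matroids given by cocircuits (ground set E, cocircuit set C)\<close>

definition is_OM :: "'a set \<Rightarrow> 'a signvec set \<Rightarrow> bool" where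
  "is_OM E C \<longleftrightarrow> finite E
     \<and> (\<forall>X\<in>C. supp X \<subseteq> E)
     \<and> zerovec \<notin> C
     \<and> (\<forall>X\<in>C. vneg X \<in> C)
     \<and> (\<forall>X\<in>C. \<forall>Y\<in>C. supp X \<subseteq> supp Y \<longrightarrow> X = Y \<or> X = vneg Y)
     \<and> (\<forall>X\<in>C. \<forall>Y\<in>C. \<forall>e. X \<noteq> vneg Y \<and> X e = Pos \<and> Y e = Neg \<longrightarrow>
          (\<exists>Z\<in>C. Z e = Zer \<and>
             (\<forall>h. Z h = Pos \<longrightarrow> X h = Pos \<or> Y h = Pos) \<and>
             (\<forall>h. Z h = Neg \<longrightarrow> X h = Neg \<or> Y h = Neg)))"

definition covectors :: "'a signvec set \<Rightarrow> 'a signvec set" where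
  "covectors C = {foldr comp Xs zerovec | Xs. set Xs \<subseteq> C}"

section \<open>The underlying matroid (its cocircuits are the supports of the cocircuits)\<close>

definition spanning :: "'a set \<Rightarrow> 'a signvec set \<Rightarrow> 'a set \<Rightarrow> bool" where
  "spanning E C S \<longleftrightarrow> S \<subseteq> E \<and> (\<forall>X\<in>C. S \<inter> supp X \<noteq> {})"

definition basis :: "'a set \<Rightarrow> 'a signvec set \<Rightarrow> 'a set \<Rightarrow> bool" where
  "basis E C B \<longleftrightarrow> spanning E C B \<and> (\<forall>B'. B' \<subset> B \<longrightarrow> \<not> spanning E C B')"

definition indep :: "'a set \<Rightarrow> 'a signvec set \<Rightarrow> 'a set \<Rightarrow> bool" where
  "indep E C I \<longleftrightarrow> (\<exists>B. basis E C B \<and> I \<subseteq> B)"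

definition mrank :: "'a set \<Rightarrow> 'a signvec set \<Rightarrow> 'a set \<Rightarrow> nat" where
  "mrank E C A = Max (card ` {I. I \<subseteq> A \<and> indep E C I})"

definition is_loop :: "'a set \<Rightarrow> 'a signvec set \<Rightarrow> 'a \<Rightarrow> bool" where
  "is_loop E C e \<longleftrightarrow> e \<in> E \<and> (\<forall>B. basis E C B \<longrightarrow> e \<notin> B)"

definition is_coloop :: "'a set \<Rightarrow> 'a signvec set \<Rightarrow> 'a \<Rightarrow> bool" where
  "is_coloop E C e \<longleftrightarrow> e \<in> E \<and> (\<forall>B. basis E C B \<longrightarrow> e \<in> B)"

definition is_edge :: "'a set \<Rightarrow> 'a signvec set \<Rightarrow> 'a signvec \<Rightarrow> bool" where
  "is_edge E C F \<longleftrightarrow> F \<in> covectors C \<and> mrank E C (zset E F) + 2 = mrank E C E"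

definition comodular :: "'a set \<Rightarrow> 'a signvec set \<Rightarrow> 'a signvec \<Rightarrow> 'a signvec \<Rightarrow> bool" where
  "comodular E C X Y \<longleftrightarrow> X \<in> C \<and> Y \<in> C \<and> X \<noteq> Y \<and> X \<noteq> vneg Y \<and> is_edge E C (comp X Y)"

text \<open>The (unique) cocircuit obtained by eliminating e between comodular X and Y.\<close>
definition elim :: "'a set \<Rightarrow> 'a signvec set \<Rightarrow> 'a signvec \<Rightarrow> 'a signvec \<Rightarrow> 'a \<Rightarrow> 'a signvec" where
  "elim E C X Y e = (THE Z. Z \<in> C \<and> Z e = Zer \<and>
      (\<forall>h. h \<notin> sep X Y \<longrightarrow> Z h = comp X Y h))"

definition is_program :: "'a set \<Rightarrow> 'a signvec set \<Rightarrow> 'a \<Rightarrow> 'a \<Rightarrow> bool" where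
  "is_program E C g f \<longleftrightarrow> g \<in> E \<and> f \<in> E \<and> g \<noteq> f \<and> \<not> is_loop E C g \<and> \<not> is_coloop E C f"

definition graph_edge :: "'a set \<Rightarrow> 'a signvec set \<Rightarrow> 'a \<Rightarrow> 'a signvec \<Rightarrow> 'a signvec \<Rightarrow> bool" where
  "graph_edge E C g X Y \<longleftrightarrow> X \<in> C \<and> Y \<in> C \<and> X g = Pos \<and> Y g = Pos
     \<and> conformal X Y \<and> comodular E C X Y"

definition arrow :: "'a set \<Rightarrow> 'a signvec set \<Rightarrow> 'a \<Rightarrow> 'a \<Rightarrow> 'a signvec \<Rightarrow> 'a signvec \<Rightarrow> bool" where
  "arrow E C g f X Y \<longleftrightarrow> elim E C (vneg X) Y g f = Pos"

definition undirected :: "'a set \<Rightarrow> 'a signvec set \<Rightarrow> 'a \<Rightarrow> 'a \<Rightarrow> 'a signvec \<Rightarrow> 'a signvec \<Rightarrow> bool" where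
  "undirected E C g f X Y \<longleftrightarrow> elim E C (vneg X) Y g f = Zer"

definition directed_cycle :: "'a set \<Rightarrow> 'a signvec set \<Rightarrow> 'a \<Rightarrow> 'a \<Rightarrow> nat \<Rightarrow> (nat \<Rightarrow> 'a signvec) \<Rightarrow> bool" where
  "directed_cycle E C g f m P \<longleftrightarrow> P m = P 0 \<and> inj_on P {0..<m}
     \<and> (\<forall>i<m. graph_edge E C g (P i) (P (Suc i)) \<and>
               (arrow E C g f (P i) (P (Suc i)) \<or> undirected E C g f (P i) (P (Suc i))))
     \<and> (\<exists>i<m. arrow E C g f (P i) (P (Suc i)))"

definition euclidean_program :: "'a set \<Rightarrow> 'a signvec set \<Rightarrow> 'a \<Rightarrow> 'a \<Rightarrow> bool" where
  "euclidean_program E C g f \<longleftrightarrow> \<not> (\<exists>m P. directed_cycle E C g f m P)"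

definition euclidean_OM :: "'a set \<Rightarrow> 'a signvec set \<Rightarrow> bool" where
  "euclidean_OM E C \<longleftrightarrow> (\<forall>g f. is_program E C g f \<longrightarrow> euclidean_program E C g f)"

definition ext_cocircuits :: "'a set \<Rightarrow> 'a signvec set \<Rightarrow> ('a signvec \<Rightarrow> sign) \<Rightarrow> 'a \<Rightarrow> 'a signvec set" where
  "ext_cocircuits E C \<sigma> p =
     {X(p := \<sigma> X) | X. X \<in> C}
   \<union> {(comp Y1 Y2)(p := Zer) | Y1 Y2. Y1 \<in> C \<and> Y2 \<in> C \<and> conformal Y1 Y2
         \<and> comodular E C Y1 Y2 \<and> \<sigma> Y1 \<noteq> Zer \<and> \<sigma> Y1 = sneg (\<sigma> Y2)}"

text \<open>Index of Y w.r.t. the ordered list I (0-based; length I if none).\<close>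
definition lex_index :: "'a list \<Rightarrow> 'a signvec \<Rightarrow> nat" where
  "lex_index I Y = (LEAST i. i = length I \<or> (i < length I \<and> Y (I ! i) \<noteq> Zer))"

definition lex_loc :: "'a list \<Rightarrow> sign list \<Rightarrow> 'a signvec \<Rightarrow> sign" where
  "lex_loc I \<alpha> Y = (let i = lex_index I Y in
      if i < length I then smult (\<alpha> ! i) (Y (I ! i)) else Zer)"

definition lex_ext :: "'a set \<Rightarrow> 'a signvec set \<Rightarrow> 'a list \<Rightarrow> sign list \<Rightarrow> 'a \<Rightarrow> 'a signvec set" where
  "lex_ext E C I \<alpha> p = ext_cocircuits E C (lex_loc I \<alpha>) p"

end

theory Submission
  imports Defs
begin

text \<open>
  Let P be a directed cycle of the program with objective f and with the lexicographic element p at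
  infinity, and let t be the first element of I that does not vanish on all of P. Along an arrow the
  sign of f cannot decrease, so it is constant on P, and it is not 0, since otherwise all edges
  would be undirected. On every edge on which t does not vanish identically, p is parallel to t or an
  infinitesimal perturbation of t. If t vanished on some but not all vertices of P, then P would both
  enter and leave the hyperplane of t; one of these two steps is against the sign of f. Hence P
  avoids the hyperplane of t and is a closed walk in the cocircuit graph with t at infinity. If the
  intersection W of some edge with this hyperplane has W(f) nonzero, P is a directed cycle of the
  Euclidean program (t, f). Otherwise f is parallel to t on all edges, and the direction of an edge
  is given by the localization of W, that is, by the first element of I not vanishing on W. Taking
  the first element e of I not vanishing on all these W, P or its reverse is a directed cycle of
  the program (t, e).
\<close>

section \<open>Sign vectors and the underlying matroid\<close>

lemma supp_vneg [simp]: "supp (vneg X) = supp X"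
proof -
  have "\<And>s. sneg s = Zer \<longleftrightarrow> s = Zer" by (case_tac s) auto
  then show ?thesis by (simp add: supp_def vneg_def)
qed

lemma sneg_sneg [simp]: "sneg (sneg s) = s" by (cases s) auto

lemma vneg_vneg [simp]: "vneg (vneg X) = X" by (simp add: vneg_def)

lemma vneg_eq_iff: "vneg X = Y \<longleftrightarrow> X = vneg Y" by auto

lemma vneg_apply [simp]: "vneg X e = sneg (X e)" by (simp add: vneg_def)

lemma sneg_eq_iff [simp]:
  "sneg s = Zer \<longleftrightarrow> s = Zer" "sneg s = Pos \<longleftrightarrow> s = Neg" "sneg s = Neg \<longleftrightarrow> s = Pos"
  "sneg s = sneg s' \<longleftrightarrow> s = s'"
  by (cases s; cases s'; simp)+

lemma sneg_fixed_iff [simp]: "s = sneg s \<longleftrightarrow> s = Zer" "sneg s = s \<longleftrightarrow> s = Zer"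
  by (cases s; simp)+

lemma smult_eq_Zer_iff [simp]:
  "smult a b = Zer \<longleftrightarrow> a = Zer \<or> b = Zer" "Zer = smult a b \<longleftrightarrow> a = Zer \<or> b = Zer"
  by (cases a; cases b; simp)+

lemma in_supp: "e \<in> supp X \<longleftrightarrow> X e \<noteq> Zer" by (simp add: supp_def)

lemma supp_comp [simp]: "supp (comp X Y) = supp X \<union> supp Y"
  by (auto simp: supp_def comp_def)

lemma comp_eq_if_conform:
  "h \<notin> sep X Y \<Longrightarrow> comp X Y h = (if Y h \<noteq> Zer then Y h else X h)"
  by (cases "X h"; cases "Y h") (auto simp: comp_def sep_def)

lemma sep_commute: "sep X Y = sep Y X"
proof -
  have "\<And>a b. a \<noteq> Zer \<and> a = sneg b \<longleftrightarrow> b \<noteq> Zer \<and> b = sneg a" by auto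
  then show ?thesis unfolding sep_def by blast
qed

lemma comp_commute_off_sep: "h \<notin> sep X Y \<Longrightarrow> comp X Y h = comp Y X h"
  by (simp add: comp_eq_if_conform) (simp add: comp_def)

section \<open>Cocircuit axioms and elimination for supports\<close>

locale om =
  fixes E :: "'a set" and C :: "'a signvec set"
  assumes OM: "is_OM E C"
begin

lemma finite_E: "finite E"
  and supp_subset: "X \<in> C \<Longrightarrow> supp X \<subseteq> E"
  and vneg_in: "X \<in> C \<Longrightarrow> vneg X \<in> C"
  and supp_incomparable: "X \<in> C \<Longrightarrow> Y \<in> C \<Longrightarrow> supp X \<subseteq> supp Y \<Longrightarrow> X = Y \<or> X = vneg Y"
  using OM by (simp_all add: is_OM_def)

lemma finite_supp: "X \<in> C \<Longrightarrow> finite (supp X)"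
  using finite_subset[OF supp_subset finite_E] .

lemma supp_nonempty: "X \<in> C \<Longrightarrow> supp X \<noteq> {}"
proof
  assume X: "X \<in> C" "supp X = {}"
  then have "X = zerovec" by (auto simp: supp_def zerovec_def)
  then show False using OM X(1) by (simp add: is_OM_def)
qed

lemma weak_elimination:
  assumes "X \<in> C" "Y \<in> C" "X \<noteq> vneg Y" "e \<in> sep X Y"
  obtains Z where "Z \<in> C" "Z e = Zer" "\<And>h. Z h = Zer \<or> Z h = X h \<or> Z h = Y h"
proof -
  have el: "\<exists>Z\<in>C. Z e = Zer \<and>
             (\<forall>h. Z h = Pos \<longrightarrow> X h = Pos \<or> Y h = Pos) \<and>
             (\<forall>h. Z h = Neg \<longrightarrow> X h = Neg \<or> Y h = Neg)"
    if "X \<in> C" "Y \<in> C" "X \<noteq> vneg Y" "X e = Pos" "Y e = Neg" for X Y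
    using OM that unfolding is_OM_def by blast
  have "X e = Pos \<and> Y e = Neg \<or> Y e = Pos \<and> X e = Neg"
    using assms(4) by (cases "X e"; cases "Y e") (auto simp: sep_def)
  moreover have "Y \<noteq> vneg X" using assms(3) by auto
  ultimately obtain Z where Z: "Z \<in> C" "Z e = Zer"
    "\<And>h. Z h = Pos \<Longrightarrow> X h = Pos \<or> Y h = Pos" "\<And>h. Z h = Neg \<Longrightarrow> X h = Neg \<or> Y h = Neg"
    using el[of X Y] el[of Y X] assms by blast
  show thesis
  proof (rule that[OF Z(1,2)])
    fix h show "Z h = Zer \<or> Z h = X h \<or> Z h = Y h"
      using Z(3,4)[of h] by (cases "Z h") auto
  qed
qed

text \<open>At a common support element the signs of \<open>X\<close> and \<open>Y\<close>, or of
  \<open>X\<close> and \<open>vneg Y\<close>, are opposite, so the signed axiom applies to one of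
  the two pairs.\<close>

lemma support_elimination:
  assumes "X \<in> C" "Y \<in> C" "X \<noteq> Y" "X \<noteq> vneg Y" "e \<in> supp X" "e \<in> supp Y"
  obtains Z where "Z \<in> C" "e \<notin> supp Z" "supp Z \<subseteq> supp X \<union> supp Y"
proof -
  have "e \<in> sep X Y \<or> e \<in> sep X (vneg Y)"
    using assms(5,6) by (cases "X e"; cases "Y e") (auto simp: sep_def supp_def)
  then consider "e \<in> sep X Y" | "e \<in> sep X (vneg Y)" by blast
  then show thesis
  proof cases
    case 1
    obtain Z where "Z \<in> C" "Z e = Zer" "\<And>h. Z h = Zer \<or> Z h = X h \<or> Z h = Y h"
      using weak_elimination[OF assms(1,2,4) 1] by metis
    then show thesis by (intro that[of Z]) (auto simp: supp_def, metis)
  next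
    case 2
    obtain Z where Z: "Z \<in> C" "Z e = Zer" "\<And>h. Z h = Zer \<or> Z h = X h \<or> Z h = vneg Y h"
      using weak_elimination[OF assms(1) vneg_in[OF assms(2)] _ 2] assms(3) by auto
    then show thesis
      by (intro that[of Z]) (auto simp: supp_def, metis sneg_eq_iff(1))
  qed
qed

text \<open>Induction on the size of the union of the supports. If the weak elimination
  \<open>Z1\<close> of \<open>d\<close> loses \<open>e\<close>, some \<open>x\<close> of
  \<open>Z1\<close> outside \<open>X\<close> is eliminated between \<open>Y\<close> and
  \<open>Z1\<close> while keeping \<open>d\<close>. The result \<open>Z2\<close> misses both
  \<open>x\<close> and \<open>e\<close>, so the union of its support with that of \<open>X\<close>
  is smaller, and \<open>d\<close> is eliminated between \<open>X\<close> and
  \<open>Z2\<close>.\<close>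

lemma strong_support_elimination:
  assumes "X \<in> C" "Y \<in> C" "d \<in> supp X" "d \<in> supp Y" "e \<in> supp X" "e \<notin> supp Y"
  shows "\<exists>Z\<in>C. e \<in> supp Z \<and> d \<notin> supp Z \<and> supp Z \<subseteq> supp X \<union> supp Y"
  using assms
proof (induction "card (supp X \<union> supp Y)" arbitrary: X Y d e rule: less_induct)
  case less
  note XY = less.prems
  have fin: "finite (supp X \<union> supp Y)" using XY(1,2) finite_supp by blast
  have ne: "X \<noteq> Y" "X \<noteq> vneg Y" using XY(5,6) by auto
  obtain Z1 where Z1: "Z1 \<in> C" "d \<notin> supp Z1" "supp Z1 \<subseteq> supp X \<union> supp Y"
    using support_elimination[OF XY(1,2) ne XY(3,4)] by metis
  show ?case
  proof (cases "e \<in> supp Z1")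
    case True
    then show ?thesis using Z1 by blast
  next
    case False
    have "\<not> supp Z1 \<subseteq> supp X"
      using supp_incomparable[OF Z1(1) XY(1)] Z1(2) XY(3) by auto
    then obtain x where x: "x \<in> supp Z1" "x \<notin> supp X" "x \<in> supp Y" using Z1(3) by blast
    have "supp Y \<union> supp Z1 \<subset> supp X \<union> supp Y" using Z1(3) False XY(5,6) by blast
    then have "card (supp Y \<union> supp Z1) < card (supp X \<union> supp Y)"
      by (rule psubset_card_mono[OF fin])
    from less.hyps[OF this XY(2) Z1(1) x(3) x(1) XY(4) Z1(2)]
    obtain Z2 where Z2: "Z2 \<in> C" "d \<in> supp Z2" "x \<notin> supp Z2" "supp Z2 \<subseteq> supp Y \<union> supp Z1"
      by blast
    have "supp X \<union> supp Z2 \<subset> supp X \<union> supp Y" using Z2 Z1 x by blast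
    then have lt: "card (supp X \<union> supp Z2) < card (supp X \<union> supp Y)"
      by (rule psubset_card_mono[OF fin])
    have "e \<notin> supp Z2" using Z2(4) False XY(6) by blast
    from less.hyps[OF lt XY(1) Z2(1) XY(3) Z2(2) XY(5) this]
    obtain Z3 where "Z3 \<in> C" "e \<in> supp Z3" "d \<notin> supp Z3" "supp Z3 \<subseteq> supp X \<union> supp Z2"
      by blast
    then show ?thesis using Z2(4) Z1(3) by blast
  qed
qed

section \<open>Independence, bases and rank of the underlying matroid\<close>

text \<open>A set is independent iff each element is cut off from the others by a hyperplane, that is,
  by a cocircuit meeting the set in that element only.\<close>

definition separated :: "'a set \<Rightarrow> bool" where
  "separated J \<longleftrightarrow> J \<subseteq> E \<and> (\<forall>e\<in>J. \<exists>X\<in>C. supp X \<inter> J = {e})"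

text \<open>\<open>X\<close> is the private cocircuit of \<open>e\<close>. A private cocircuit of an
  old element that passes through \<open>e\<close> is repaired by eliminating \<open>e\<close>
  against \<open>X\<close>.\<close>

lemma separated_insert:
  assumes J: "separated J" and X: "X \<in> C" "supp X \<inter> J = {}" "e \<in> supp X"
  shows "separated (insert e J)"
  unfolding separated_def
proof (intro conjI ballI)
  show "insert e J \<subseteq> E" using J X supp_subset unfolding separated_def by blast
next
  fix a assume a: "a \<in> insert e J"
  show "\<exists>Z\<in>C. supp Z \<inter> insert e J = {a}"
  proof (cases "a = e")
    case True
    then show ?thesis using X by blast
  next
    case False
    then have aJ: "a \<in> J" using a by blast
    then obtain Y where Y: "Y \<in> C" "supp Y \<inter> J = {a}" using J unfolding separated_def by blast
    show ?thesis
    proof (cases "e \<in> supp Y")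
      case True
      have "a \<in> supp Y" "a \<notin> supp X" using Y(2) X(2) aJ by blast+
      then obtain Z where "Z \<in> C" "a \<in> supp Z" "e \<notin> supp Z" "supp Z \<subseteq> supp Y \<union> supp X"
        using strong_support_elimination[OF Y(1) X(1) True X(3)] by blast
      then show ?thesis using Y(2) X(2) aJ by (intro bexI[of _ Z]) blast+
    next
      case False
      then show ?thesis using Y by (intro bexI[of _ Y]) blast+
    qed
  qed
qed

lemma separated_mono: "separated J \<Longrightarrow> K \<subseteq> J \<Longrightarrow> separated K"
  unfolding separated_def
proof (elim conjE, intro conjI ballI)
  fix e assume "K \<subseteq> J" "\<forall>e\<in>J. \<exists>X\<in>C. supp X \<inter> J = {e}" "e \<in> K"
  then obtain X where "X \<in> C" "supp X \<inter> J = {e}" by blast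
  then show "\<exists>X\<in>C. supp X \<inter> K = {e}" using \<open>K \<subseteq> J\<close> \<open>e \<in> K\<close> by (intro bexI[of _ X]) blast+
qed blast

lemma basis_imp_separated: "basis E C B \<Longrightarrow> separated B"
  unfolding separated_def
proof (intro conjI ballI)
  assume B: "basis E C B"
  then show "B \<subseteq> E" by (simp add: basis_def spanning_def)
  fix e assume e: "e \<in> B"
  then have "\<not> spanning E C (B - {e})" using B by (auto simp: basis_def)
  then obtain X where X: "X \<in> C" "(B - {e}) \<inter> supp X = {}" using \<open>B \<subseteq> E\<close>
    unfolding spanning_def by blast
  moreover have "B \<inter> supp X \<noteq> {}" using B X(1) by (auto simp: basis_def spanning_def)
  ultimately show "\<exists>X\<in>C. supp X \<inter> B = {e}" by blast
qed

text \<open>A maximal separated set between \<open>J\<close> and \<open>S\<close> meets every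
  cocircuit, since a missed one would allow an insertion; its private cocircuits make it minimal
  among the spanning sets.\<close>

lemma separated_extends_to_basis:
  assumes J: "separated J" "J \<subseteq> S" and S: "spanning E C S"
  shows "\<exists>B. basis E C B \<and> J \<subseteq> B \<and> B \<subseteq> S"
proof -
  have finS: "finite S" using S finite_subset[OF _ finite_E] unfolding spanning_def by auto
  define \<F> where "\<F> = {B. separated B \<and> J \<subseteq> B \<and> B \<subseteq> S}"
  have "finite \<F>" unfolding \<F>_def using finS by (auto intro: finite_subset[of _ "Pow S"])
  moreover have "J \<in> \<F>" using J by (simp add: \<F>_def)
  ultimately obtain B where B: "B \<in> \<F>" "\<And>B'. B' \<in> \<F> \<Longrightarrow> B \<subseteq> B' \<Longrightarrow> B = B'"
    using finite_has_maximal[of \<F>] by blast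
  have sB: "separated B" "J \<subseteq> B" "B \<subseteq> S" using B(1) by (auto simp: \<F>_def)
  have "spanning E C B"
    unfolding spanning_def
  proof (intro conjI ballI notI)
    show "B \<subseteq> E" using sB by (simp add: separated_def)
    fix X assume X: "X \<in> C" "B \<inter> supp X = {}"
    obtain e where e: "e \<in> S" "e \<in> supp X" using S X(1) unfolding spanning_def by blast
    have "insert e B \<in> \<F>"
      using separated_insert[OF sB(1) X(1) _ e(2)] X(2) sB e(1) by (auto simp: \<F>_def)
    then show False using B(2) e X(2) by blast
  qed
  moreover have "\<not> spanning E C B'" if B': "B' \<subset> B" for B'
  proof -
    obtain e where e: "e \<in> B" "e \<notin> B'" using B' by blast
    then obtain X where X: "X \<in> C" "supp X \<inter> B = {e}"
      using sB(1) unfolding separated_def by blast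
    then have "B' \<inter> supp X = {}" using B' e by auto
    then show ?thesis using X(1) unfolding spanning_def by blast
  qed
  ultimately show ?thesis using sB unfolding basis_def by blast
qed

lemma spanning_ground: "spanning E C E"
  unfolding spanning_def using supp_subset supp_nonempty by blast

lemma indep_iff_separated: "indep E C J \<longleftrightarrow> separated J"
proof
  show "indep E C J \<Longrightarrow> separated J"
    unfolding indep_def using basis_imp_separated separated_mono by blast
  assume J: "separated J"
  then have "J \<subseteq> E" by (simp add: separated_def)
  from separated_extends_to_basis[OF J this spanning_ground] show "indep E C J"
    unfolding indep_def by blast
qed

text \<open>Steinitz exchange: an element of \<open>J\<close> outside \<open>S\<close> is traded for
  an element of \<open>S\<close> on its private cocircuit. This keeps the size of \<open>J\<close>
  and brings it closer to \<open>S\<close>.\<close>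

lemma card_separated_le_spanning:
  assumes "separated J" "spanning E C S"
  shows "card J \<le> card S"
  using assms(1)
proof (induction "card (J - S)" arbitrary: J rule: less_induct)
  case less
  have fin: "finite J" "finite S" using less.prems assms(2) finite_subset[OF _ finite_E]
    unfolding separated_def spanning_def by auto
  show ?case
  proof (cases "J \<subseteq> S")
    case True
    then show ?thesis using fin by (simp add: card_mono)
  next
    case False
    then obtain e where e: "e \<in> J" "e \<notin> S" by blast
    obtain X where X: "X \<in> C" "supp X \<inter> J = {e}"
      using less.prems e unfolding separated_def by blast
    obtain s where s: "s \<in> S" "s \<in> supp X" using assms(2) X(1) unfolding spanning_def by blast
    have sJ: "s \<notin> J" using X(2) e s by auto
    define J' where "J' = insert s (J - {e})"
    have sep: "separated J'" unfolding J'_def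
      by (rule separated_insert[OF separated_mono[OF less.prems] X(1) _ s(2)]) (use X(2) in auto)
    have "J' - S \<subset> J - S" unfolding J'_def using e s by auto
    then have "card (J' - S) < card (J - S)" using fin by (simp add: psubset_card_mono)
    from less.hyps[OF this sep] have "card J' \<le> card S" .
    moreover have "card J' = card J" unfolding J'_def using sJ fin e
      by (simp add: card_Suc_Diff1 del: card_Diff_insert)
    ultimately show ?thesis by simp
  qed
qed

lemma mrank_ge: "separated J \<Longrightarrow> J \<subseteq> A \<Longrightarrow> card J \<le> mrank E C A"
  and mrank_attained: "\<exists>J. separated J \<and> J \<subseteq> A \<and> card J = mrank E C A"
proof -
  let ?F = "{J. J \<subseteq> A \<and> indep E C J}"
  have "finite ?F" using finite_E
    by (auto intro!: finite_subset[of _ "Pow E"] simp: indep_iff_separated separated_def)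
  moreover have "{} \<in> ?F" by (simp add: indep_iff_separated separated_def)
  ultimately have "mrank E C A \<in> card ` ?F" "\<And>J. J \<in> ?F \<Longrightarrow> card J \<le> mrank E C A"
    unfolding mrank_def by (auto intro!: Max_in Max_ge)
  then show "\<exists>J. separated J \<and> J \<subseteq> A \<and> card J = mrank E C A"
    and "separated J \<Longrightarrow> J \<subseteq> A \<Longrightarrow> card J \<le> mrank E C A"
    by (auto simp: indep_iff_separated)
qed

lemma card_basis: "basis E C B \<Longrightarrow> card B = mrank E C E"
proof (rule antisym)
  assume B: "basis E C B"
  then have sp: "spanning E C B" by (simp add: basis_def)
  then have "B \<subseteq> E" by (simp add: spanning_def)
  then show "card B \<le> mrank E C E" by (rule mrank_ge[OF basis_imp_separated[OF B]])
  show "mrank E C E \<le> card B" using mrank_attained[of E] card_separated_le_spanning[OF _ sp] by metis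
qed

section \<open>Pencils of hyperplanes through a flat of corank 2\<close>

text \<open>S is meant to be the complement of a flat of corank 2: the hyperplanes through such a flat meet
  pairwise exactly in the flat.\<close>

definition pencil :: "'a set \<Rightarrow> bool" where
  "pencil S \<longleftrightarrow> (\<forall>Z1\<in>C. \<forall>Z2\<in>C. supp Z1 \<subseteq> S \<longrightarrow> supp Z2 \<subseteq> S \<longrightarrow> Z1 \<noteq> Z2 \<longrightarrow> Z1 \<noteq> vneg Z2
     \<longrightarrow> supp Z1 \<union> supp Z2 = S)"

text \<open>If \<open>Z1\<close> and \<open>Z2\<close> both missed an element \<open>e\<close>
  outside the flat, a basis of the flat could be enlarged by \<open>e\<close>, an element of
  \<open>Z1\<close> only and an element of \<open>Z2\<close> only, which gives an independent set
  larger than the rank.\<close>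

lemma comodular_imp_pencil:
  assumes "comodular E C X Y"
  shows "pencil (supp X \<union> supp Y)"
  unfolding pencil_def
proof (intro ballI impI, rule ccontr)
  fix Z1 Z2 assume Z: "Z1 \<in> C" "Z2 \<in> C" "supp Z1 \<subseteq> supp X \<union> supp Y" "supp Z2 \<subseteq> supp X \<union> supp Y"
    "Z1 \<noteq> Z2" "Z1 \<noteq> vneg Z2" and "supp Z1 \<union> supp Z2 \<noteq> supp X \<union> supp Y"
  then obtain e where e: "e \<in> supp X \<union> supp Y" "e \<notin> supp Z1" "e \<notin> supp Z2" by blast
  have XY: "X \<in> C" "Y \<in> C" using assms by (auto simp: comodular_def)
  let ?L = "zset E (comp X Y)"
  have L: "?L \<inter> (supp X \<union> supp Y) = {}"
    unfolding supp_comp[symmetric] by (auto simp: zset_def supp_def)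
  obtain J where J: "separated J" "J \<subseteq> ?L" "card J = mrank E C ?L" using mrank_attained by blast
  have rk: "mrank E C ?L + 2 = mrank E C E" using assms by (simp add: comodular_def is_edge_def)
  obtain h where h: "h \<in> supp Z1" "h \<notin> supp Z2" using supp_incomparable[OF Z(1,2)] Z(5,6) by blast
  obtain g where g: "g \<in> supp Z2" "g \<notin> supp Z1"
    using supp_incomparable[OF Z(2,1)] Z(5,6) vneg_eq_iff by blast
  have "separated (insert e J)"
    using e(1) separated_insert[OF J(1) XY(1), of e] separated_insert[OF J(1) XY(2), of e] J(2) L
    by blast
  then have "separated (insert h (insert e J))"
    using separated_insert[OF _ Z(1) _ h(1)] e(2) J(2) L Z(3) by blast
  then have s: "separated (insert g (insert h (insert e J)))"
    using separated_insert[OF _ Z(2) _ g(1)] e(3) h(2) J(2) L Z(4) by blast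
  have "e \<notin> J" "h \<notin> insert e J" "g \<notin> insert h (insert e J)"
    using e h g J(2) L Z(3,4) by blast+
  moreover have "finite J" using J(1) finite_subset[OF _ finite_E] unfolding separated_def by auto
  ultimately have "card (insert g (insert h (insert e J))) = mrank E C E + 1"
    using rk J(3) by simp
  moreover have "card (insert g (insert h (insert e J))) \<le> mrank E C E"
    using mrank_ge[OF s] s unfolding separated_def by blast
  ultimately show False by simp
qed

lemma comp_in_covectors: "X \<in> C \<Longrightarrow> Y \<in> C \<Longrightarrow> comp X Y \<in> covectors C"
  unfolding covectors_def
  by (rule CollectI, rule exI[of _ "[X, Y]"]) (auto simp: comp_def zerovec_def fun_eq_iff)

lemma zset_comp_eq: "zset E (comp X Y) = E - (supp X \<union> supp Y)"
  unfolding supp_comp[symmetric] by (auto simp: zset_def supp_def)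

text \<open>Any two members of the pencil that are not equal or opposite have the same common zero
  set as \<open>X\<close> and \<open>Y\<close>, so they span the same flat of corank 2.\<close>

lemma comodular_pencil_members:
  assumes "comodular E C X Y" "Z1 \<in> C" "Z2 \<in> C" "supp Z1 \<subseteq> supp X \<union> supp Y"
    "supp Z2 \<subseteq> supp X \<union> supp Y" "Z1 \<noteq> Z2" "Z1 \<noteq> vneg Z2"
  shows "comodular E C Z1 Z2"
proof -
  have "supp Z1 \<union> supp Z2 = supp X \<union> supp Y"
    using comodular_imp_pencil[OF assms(1)] assms(2-) unfolding pencil_def by blast
  then have "zset E (comp Z1 Z2) = zset E (comp X Y)" by (simp add: zset_comp_eq)
  then show ?thesis using assms comp_in_covectors by (simp add: comodular_def is_edge_def)
qed

end

section \<open>Modular elimination in pencils\<close>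

context om
begin

lemma cocircuit_zero_off_support: "X \<in> C \<Longrightarrow> e \<notin> E \<Longrightarrow> X e = Zer"
  using supp_subset by (auto simp: supp_def)

text \<open>The flat and one element outside it lie on only one hyperplane of the pencil, and a
  hyperplane fixes its cocircuit up to sign.\<close>

lemma pencil_common_zero:
  assumes "pencil S" "Z1 \<in> C" "supp Z1 \<subseteq> S" "Z2 \<in> C" "supp Z2 \<subseteq> S" "e \<in> S" "Z1 e = Zer" "Z2 e = Zer"
  shows "Z1 = Z2 \<or> Z1 = vneg Z2"
proof (rule ccontr)
  assume "\<not> ?thesis"
  then have "supp Z1 \<union> supp Z2 = S" using assms unfolding pencil_def by blast
  then show False using assms(6-8) by (auto simp: in_supp)
qed

lemma private_element:
  assumes "X \<in> C" "Y \<in> C" "X \<noteq> Y" "X \<noteq> vneg Y"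
  obtains d where "X d \<noteq> Zer" "Y d = Zer"
  using supp_incomparable[OF assms(1,2)] assms(3,4) by (auto simp: supp_def)

text \<open>Both candidates vanish at \<open>e\<close>, hence agree up to sign; a private element of
  \<open>X\<close> fixes the sign.\<close>

lemma pencil_elim_unique:
  assumes S: "pencil S" and X: "X \<in> C" "supp X \<subseteq> S" and Y: "Y \<in> C" "supp Y \<subseteq> S"
    and ne: "X \<noteq> Y" "X \<noteq> vneg Y" and e: "e \<in> S"
    and Z1: "Z1 \<in> C" "Z1 e = Zer" "\<And>h. h \<notin> sep X Y \<Longrightarrow> Z1 h = comp X Y h"
    and Z2: "Z2 \<in> C" "Z2 e = Zer" "\<And>h. h \<notin> sep X Y \<Longrightarrow> Z2 h = comp X Y h"
  shows "Z1 = Z2"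
proof -
  have "supp Z \<subseteq> S" if "\<And>h. h \<notin> sep X Y \<Longrightarrow> Z h = comp X Y h" for Z
  proof
    fix h assume "h \<in> supp Z"
    then have "h \<in> supp X \<union> supp Y" using that[of h]
      by (cases "h \<in> sep X Y") (auto simp: in_supp sep_def comp_def split: if_splits)
    then show "h \<in> S" using X Y by blast
  qed
  then have *: "Z1 = Z2 \<or> Z1 = vneg Z2"
    using pencil_common_zero[OF S Z1(1) _ Z2(1) _ e Z1(2) Z2(2)] Z1(3) Z2(3) by blast
  obtain d where d: "X d \<noteq> Zer" "Y d = Zer" using private_element[OF X(1) Y(1) ne] .
  then have "Z1 d = X d" "Z2 d = X d" using Z1(3)[of d] Z2(3)[of d] by (auto simp: sep_def comp_def)
  then show ?thesis using * d by auto
qed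

text \<open>The weak elimination already works: the pencil property forces it to be nonzero wherever
  \<open>X\<close> or \<open>Y\<close> vanishes on \<open>S\<close>, and a comparison with the pair
  \<open>X\<close>, \<open>vneg Y\<close> handles the elements where \<open>X\<close> and
  \<open>Y\<close> agree.\<close>

lemma pencil_elim_exists:
  assumes S: "pencil S" and X: "X \<in> C" "supp X \<subseteq> S" and Y: "Y \<in> C" "supp Y \<subseteq> S"
    and ne: "X \<noteq> Y" "X \<noteq> vneg Y" and e: "e \<in> sep X Y"
  obtains Z where "Z \<in> C" "supp Z \<subseteq> S" "Z e = Zer" "\<And>h. h \<notin> sep X Y \<Longrightarrow> Z h = comp X Y h"
proof -
  \<comment> \<open>Stated for arbitrary members of the pencil because it is applied to
    \<open>X\<close>, \<open>Y\<close> and again to \<open>X\<close>, \<open>vneg Y\<close>.\<close>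
  have elim: "\<exists>Z. Z \<in> C \<and> supp Z \<subseteq> S \<and> Z e = Zer \<and> (\<forall>h. Z h = Zer \<or> Z h = X h \<or> Z h = Y h)
      \<and> (\<forall>h\<in>S. (X h = Zer \<longrightarrow> Z h = Y h) \<and> (Y h = Zer \<longrightarrow> Z h = X h))"
    if X: "X \<in> C" "supp X \<subseteq> S" and Y: "Y \<in> C" "supp Y \<subseteq> S"
      and ne: "X \<noteq> Y" "X \<noteq> vneg Y" and e: "e \<in> sep X Y" for X Y e
  proof -
    obtain Z where Z: "Z \<in> C" "Z e = Zer" "\<And>h. Z h = Zer \<or> Z h = X h \<or> Z h = Y h"
      using weak_elimination[OF X(1) Y(1) ne(2) e] by metis
    have sZ: "supp Z \<subseteq> S"
    proof
      fix h assume "h \<in> supp Z"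
      then have "h \<in> supp X \<union> supp Y" using Z(3)[of h] by (auto simp: in_supp)
      then show "h \<in> S" using X Y by blast
    qed
    have nz: "X e \<noteq> Zer" "Y e \<noteq> Zer" using e by (auto simp: sep_def)
    then have "Z \<noteq> X" "Z \<noteq> vneg X" "Z \<noteq> Y" "Z \<noteq> vneg Y" using Z(2) by auto
    then have "supp Z \<union> supp X = S" "supp Z \<union> supp Y = S"
      using S Z(1) sZ X Y unfolding pencil_def by blast+
    then have "\<forall>h\<in>S. (X h = Zer \<longrightarrow> Z h = Y h) \<and> (Y h = Zer \<longrightarrow> Z h = X h)"
      using Z(3) by (metis Un_iff in_supp)
    then show ?thesis using Z sZ by blast
  qed
  obtain Z where Z: "Z \<in> C" "supp Z \<subseteq> S" "Z e = Zer" "\<And>h. Z h = Zer \<or> Z h = X h \<or> Z h = Y h"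
    "\<And>h. h \<in> S \<Longrightarrow> X h = Zer \<Longrightarrow> Z h = Y h" "\<And>h. h \<in> S \<Longrightarrow> Y h = Zer \<Longrightarrow> Z h = X h"
    using elim[OF X Y ne e] by blast
  have "Z h = comp X Y h" if h: "h \<notin> sep X Y" for h
  proof (rule ccontr)
    assume neq: "Z h \<noteq> comp X Y h"
    have hS: "h \<in> S"
    proof (rule ccontr)
      assume "h \<notin> S"
      then have "Z h = Zer" "X h = Zer" "Y h = Zer" using Z(2) X(2) Y(2) by (auto simp: supp_def)
      then show False using neq by (simp add: comp_def)
    qed
    \<comment> \<open>The only failure left is a zero of \<open>Z\<close> at an element where
      \<open>X\<close> and \<open>Y\<close> have the same nonzero sign.\<close>
    have eqs: "X h \<noteq> Zer" "Y h = X h" "Z h = Zer"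
      using neq Z(4)[of h] Z(5,6)[OF hS] h
      by (cases "X h"; cases "Y h"; auto simp: comp_def sep_def)+
    \<comment> \<open>Eliminating h between X and -Y gives a multiple of Z, but it agrees with X on the private
       elements of X and with -Y on those of Y.\<close>
    have hs: "h \<in> sep X (vneg Y)" using eqs by (simp add: sep_def)
    have nY: "vneg Y \<in> C" "supp (vneg Y) \<subseteq> S" "X \<noteq> vneg Y" "X \<noteq> vneg (vneg Y)"
      using Y ne vneg_in by auto
    obtain Z' where Z': "Z' \<in> C" "supp Z' \<subseteq> S" "Z' h = Zer"
      "\<And>h. h \<in> S \<Longrightarrow> X h = Zer \<Longrightarrow> Z' h = vneg Y h" "\<And>h. h \<in> S \<Longrightarrow> vneg Y h = Zer \<Longrightarrow> Z' h = X h"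
      using elim[OF X nY(1,2,3,4) hs] by blast
    have "Z = Z' \<or> Z = vneg Z'"
      using pencil_common_zero[OF S Z(1,2) Z'(1,2) hS eqs(3) Z'(3)] .
    moreover obtain d where d: "X d \<noteq> Zer" "Y d = Zer" using private_element[OF X(1) Y(1) ne] .
    moreover obtain d' where d': "Y d' \<noteq> Zer" "X d' = Zer"
      using private_element[OF Y(1) X(1)] ne vneg_eq_iff by metis
    moreover have "d \<in> S" "d' \<in> S" using d d' X Y by (auto simp: supp_def)
    ultimately show False
      using Z(5)[of d'] Z(6)[of d] Z'(4)[of d'] Z'(5)[of d] by auto
  qed
  then show thesis using that Z by blast
qed

lemma elim_eqI:
  assumes com: "comodular E C X Y" and e: "e \<in> sep X Y"
    and Z: "Z \<in> C" "Z e = Zer" "\<And>h. h \<notin> sep X Y \<Longrightarrow> Z h = comp X Y h"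
  shows "elim E C X Y e = Z"
  unfolding elim_def
proof (rule the_equality)
  show "Z \<in> C \<and> Z e = Zer \<and> (\<forall>h. h \<notin> sep X Y \<longrightarrow> Z h = comp X Y h)" using Z by blast
  have XY: "X \<in> C" "Y \<in> C" "X \<noteq> Y" "X \<noteq> vneg Y" using com by (auto simp: comodular_def)
  have eS: "e \<in> supp X \<union> supp Y" using e by (auto simp: sep_def supp_def)
  fix Z' assume "Z' \<in> C \<and> Z' e = Zer \<and> (\<forall>h. h \<notin> sep X Y \<longrightarrow> Z' h = comp X Y h)"
  then show "Z' = Z"
    using pencil_elim_unique[OF comodular_imp_pencil[OF com] XY(1) _ XY(2) _ XY(3,4) eS _ _ _ Z]
    by auto
qed

text \<open>This gives the neighbour of \<open>W\<close> in the pencil on the side of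
  \<open>U\<close>. Eliminating an element of \<open>sep U W\<close> between \<open>U\<close> and
  \<open>W\<close> shrinks the separation set and keeps the values of \<open>U\<close> at all zeros
  of \<open>W\<close>, in particular at \<open>t\<close>.\<close>

lemma pencil_conformal_exists:
  assumes S: "pencil S" and W: "W \<in> C" "supp W \<subseteq> S" "W t = Zer"
    and U: "U \<in> C" "supp U \<subseteq> S" "U t \<noteq> Zer"
  shows "\<exists>V\<in>C. supp V \<subseteq> S \<and> V t = U t \<and> sep V W = {} \<and> (\<forall>h. W h = Zer \<longrightarrow> V h = U h)"
  using U
proof (induction "card (sep U W)" arbitrary: U rule: less_induct)
  case less
  show ?case
  proof (cases "sep U W = {}")
    case True
    then show ?thesis using less.prems by blast
  next
    case False
    then obtain h where h: "h \<in> sep U W" by blast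
    have ne: "U \<noteq> W" "U \<noteq> vneg W" using less.prems(3) W(3) by auto
    obtain V where V: "V \<in> C" "supp V \<subseteq> S" "V h = Zer" "\<And>h. h \<notin> sep U W \<Longrightarrow> V h = comp U W h"
      using pencil_elim_exists[OF S less.prems(1,2) W(1,2) ne h] by metis
    have off: "V x = U x" if "W x = Zer" for x
      using V(4)[of x] that by (auto simp: sep_def comp_def)
    have "sep V W \<subset> sep U W"
    proof
      show "sep V W \<subseteq> sep U W"
      proof (rule subsetI, rule ccontr)
        fix x assume x: "x \<in> sep V W" "x \<notin> sep U W"
        then have "V x = comp U W x" using V(4) by blast
        then show False using x
          by (cases "U x"; cases "W x") (auto simp: sep_def comp_def)
      qed
      show "sep V W \<noteq> sep U W" using h V(3) by (auto simp: sep_def)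
    qed
    moreover have "finite (sep U W)"
      by (rule finite_subset[OF _ finite_supp[OF less.prems(1)]]) (auto simp: sep_def supp_def)
    ultimately have lt: "card (sep V W) < card (sep U W)" by (rule psubset_card_mono[rotated])
    have "V t \<noteq> Zer" using off[OF W(3)] less.prems(3) by simp
    from less.hyps[OF lt V(1,2) this] obtain V' where V': "V' \<in> C" "supp V' \<subseteq> S" "V' t = V t"
      "sep V' W = {}" "\<And>h. W h = Zer \<Longrightarrow> V' h = V h" by blast
    then show ?thesis using off W(3) by (intro bexI[of _ V']) auto
  qed
qed

text \<open>On each side of \<open>t\<close> the neighbour of \<open>W\<close> is unique. Otherwise
  eliminating \<open>t\<close> between \<open>V\<close> and \<open>vneg V'\<close> yields
  \<open>W\<close> or \<open>vneg W\<close>, with the sign of \<open>V\<close> at a private element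
  of \<open>V\<close> and the opposite of \<open>V'\<close> at one of \<open>V'\<close>; one of
  these contradicts conformality with \<open>W\<close>.\<close>

lemma pencil_conformal_unique:
  assumes S: "pencil S" "t \<in> S" and W: "W \<in> C" "supp W \<subseteq> S" "W t = Zer"
    and V: "V \<in> C" "supp V \<subseteq> S" "sep V W = {}" and V': "V' \<in> C" "supp V' \<subseteq> S" "sep V' W = {}"
    and t: "V t = V' t" "V t \<noteq> Zer"
  shows "V = V'"
proof (rule ccontr)
  assume neq: "V \<noteq> V'"
  have neq': "V \<noteq> vneg V'" using t by auto
  have nV: "vneg V' \<in> C" "supp (vneg V') \<subseteq> S" "V \<noteq> vneg V'" "V \<noteq> vneg (vneg V')"
    using V' vneg_in neq neq' by auto
  have ts: "t \<in> sep V (vneg V')" using t by (simp add: sep_def)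
  obtain U where U: "U \<in> C" "supp U \<subseteq> S" "U t = Zer"
    "\<And>h. h \<notin> sep V (vneg V') \<Longrightarrow> U h = comp V (vneg V') h"
    using pencil_elim_exists[OF S(1) V(1,2) nV ts] by metis
  obtain d where d: "V d \<noteq> Zer" "V' d = Zer" using private_element[OF V(1) V'(1) neq neq'] .
  obtain d' where d': "V' d' \<noteq> Zer" "V d' = Zer"
    using private_element[OF V'(1) V(1)] neq neq' vneg_eq_iff by metis
  have "U d = V d" "U d' = sneg (V' d')"
    using U(4)[of d] U(4)[of d'] d d' by (auto simp: sep_def comp_def)
  moreover have "U = W \<or> U = vneg W" using pencil_common_zero[OF S(1) U(1,2) W(1,2) S(2) U(3) W(3)] .
  moreover have "\<not> (V d \<noteq> Zer \<and> V d = sneg (W d))" "\<not> (V' d' \<noteq> Zer \<and> V' d' = sneg (W d'))"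
    using V(3) V'(3) unfolding sep_def by blast+
  ultimately show False using d d' by auto
qed

text \<open>If \<open>W\<close> vanishes at both \<open>t\<close> and \<open>f\<close>, these are
  parallel in the pencil. Eliminating \<open>t\<close> between \<open>V\<close> and
  \<open>vneg X\<close> gives a multiple of \<open>W\<close>, which vanishes at \<open>f\<close>; so
  \<open>f\<close> lies in the separation set.\<close>

lemma pencil_parallel:
  assumes S: "pencil S" "t \<in> S" and W: "W \<in> C" "supp W \<subseteq> S" "W t = Zer" "W f = Zer"
    and X: "X \<in> C" "supp X \<subseteq> S" "X f \<noteq> Zer" and V: "V \<in> C" "supp V \<subseteq> S" "V t = X t" "V t \<noteq> Zer"
  shows "V f = X f"
proof (cases "V = X")
  case False
  have nX: "vneg X \<in> C" "supp (vneg X) \<subseteq> S" "V \<noteq> vneg X" "V \<noteq> vneg (vneg X)"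
    using X vneg_in V(3,4) False by auto
  have ts: "t \<in> sep V (vneg X)" using V by (simp add: sep_def)
  obtain U where U: "U \<in> C" "supp U \<subseteq> S" "U t = Zer"
    "\<And>h. h \<notin> sep V (vneg X) \<Longrightarrow> U h = comp V (vneg X) h"
    using pencil_elim_exists[OF S(1) V(1,2) nX ts] by metis
  have "U = W \<or> U = vneg W" using pencil_common_zero[OF S(1) U(1,2) W(1,2) S(2) U(3) W(3)] .
  then have "U f = Zer" using W(4) by auto
  then have "f \<in> sep V (vneg X)"
    using U(4)[of f] X(3) by (cases "f \<in> sep V (vneg X)") (auto simp: comp_def split: if_splits)
  then show ?thesis by (simp add: sep_def)
qed simp

end

section \<open>Elimination of a new element\<close>

context om
begin

lemma comodular_cases:
  assumes "comodular E C X Y"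
  shows "X \<in> C" "Y \<in> C" "X \<noteq> Y" "X \<noteq> vneg Y"
  using assms by (auto simp: comodular_def)

lemma zero_cocircuits_of_ext:
  assumes p: "p \<notin> E"
  shows "Z \<in> ext_cocircuits E C \<sigma> p \<and> Z p = Zer \<longleftrightarrow>
    Z \<in> C \<and> \<sigma> Z = Zer \<or>
    (\<exists>Y1 Y2. Z = comp Y1 Y2 \<and> conformal Y1 Y2 \<and> comodular E C Y1 Y2 \<and>
       \<sigma> Y1 \<noteq> Zer \<and> \<sigma> Y1 = sneg (\<sigma> Y2))" (is "?l \<longleftrightarrow> ?r")
proof -
  have upd: "X(p := Zer) = X" if "X \<in> C" for X
    using cocircuit_zero_off_support[OF that p] by auto
  have updc: "(comp Y1 Y2)(p := Zer) = comp Y1 Y2" if "Y1 \<in> C" "Y2 \<in> C" for Y1 Y2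
    using that[THEN cocircuit_zero_off_support[OF _ p]] by (auto simp: comp_def)
  show ?thesis
  proof
    assume l: ?l
    then consider X where "X \<in> C" "Z = X(p := \<sigma> X)"
      | Y1 Y2 where "Z = (comp Y1 Y2)(p := Zer)" "Y1 \<in> C" "Y2 \<in> C" "conformal Y1 Y2"
        "comodular E C Y1 Y2" "\<sigma> Y1 \<noteq> Zer" "\<sigma> Y1 = sneg (\<sigma> Y2)"
      unfolding ext_cocircuits_def by blast
    then show ?r
    proof cases
      case 1
      then have "\<sigma> X = Zer" using l by simp
      then show ?thesis using 1 upd[of X] by auto
    next
      case 2
      then have "Z = comp Y1 Y2" using updc by simp
      then show ?thesis using 2 by blast
    qed
  next
    assume ?r
    then show ?l
    proof
      assume Z: "Z \<in> C \<and> \<sigma> Z = Zer"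
      then have "Z = Z(p := \<sigma> Z)" using upd by simp
      then show ?l using Z unfolding ext_cocircuits_def
        by (metis (mono_tags, lifting) UnI1 mem_Collect_eq fun_upd_same)
    next
      assume "\<exists>Y1 Y2. Z = comp Y1 Y2 \<and> conformal Y1 Y2 \<and> comodular E C Y1 Y2 \<and>
        \<sigma> Y1 \<noteq> Zer \<and> \<sigma> Y1 = sneg (\<sigma> Y2)"
      then obtain Y1 Y2 where Y: "Z = comp Y1 Y2" "conformal Y1 Y2" "comodular E C Y1 Y2"
        "\<sigma> Y1 \<noteq> Zer" "\<sigma> Y1 = sneg (\<sigma> Y2)" by blast
      have "Y1 \<in> C" "Y2 \<in> C" using comodular_cases[OF Y(3)] by auto
      then have "Z = (comp Y1 Y2)(p := Zer)" using Y(1) updc by simp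
      moreover from this have "Z p = Zer" by simp
      ultimately show ?l using Y \<open>Y1 \<in> C\<close> \<open>Y2 \<in> C\<close> unfolding ext_cocircuits_def by blast
    qed
  qed
qed

text \<open>On a pencil whose leading element is t, the new element p is parallel to t if the cocircuit W
  of the pencil vanishing on t has sign 0, and is otherwise a perturbation of t, so that the zero of
  p lies on the edge between W and one of its two neighbours.\<close>

lemma elim_new_element:
  assumes p: "p \<notin> E" and com: "comodular E C X Y"
    and \<sigma>_vneg: "\<And>Z. Z \<in> C \<Longrightarrow> \<sigma> (vneg Z) = sneg (\<sigma> Z)"
    and lead: "\<And>Z. Z \<in> C \<Longrightarrow> supp Z \<subseteq> supp X \<union> supp Y \<Longrightarrow> Z t \<noteq> Zer \<Longrightarrow> \<sigma> Z = smult a (Z t)"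
    and a: "a \<noteq> Zer" and t: "t \<in> supp X \<union> supp Y"
    and \<sigma>: "\<sigma> X = Neg" "\<sigma> Y = Pos"
    and W: "W \<in> C" "supp W \<subseteq> supp X \<union> supp Y" "W t = Zer"
      "\<And>h. h \<notin> sep X Y \<Longrightarrow> W h \<noteq> Zer \<Longrightarrow> W h = comp X Y h"
  shows "\<exists>Z. elim (insert p E) (ext_cocircuits E C \<sigma> p) (X(p := Neg)) (Y(p := Pos)) p = Z \<and>
    (\<forall>h\<in>E. h \<notin> sep X Y \<longrightarrow> Z h = comp X Y h) \<and>
    (\<forall>h. W h \<noteq> Zer \<longrightarrow> Z h = W h) \<and>
    (\<sigma> W = Zer \<longrightarrow> Z = W) \<and>
    (\<sigma> W \<noteq> Zer \<longrightarrow> (\<exists>V\<in>C. supp V \<subseteq> supp X \<union> supp Y \<and> V t = sneg (smult a (\<sigma> W)) \<and>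
       (\<forall>h. W h = Zer \<longrightarrow> Z h = V h)))"
proof -
  define S where "S = supp X \<union> supp Y"
  note XY = comodular_cases[OF com]
  have S: "pencil S" unfolding S_def by (rule comodular_imp_pencil[OF com])
  have XS: "supp X \<subseteq> S" "supp Y \<subseteq> S" by (auto simp: S_def)
  have WS: "supp W \<subseteq> S" using W(2) by (simp add: S_def)
  have tS: "t \<in> S" using t by (simp add: S_def)
  have zp: "Z p = Zer" if "Z \<in> C" for Z using cocircuit_zero_off_support[OF that p] .
  have sep': "sep (X(p := Neg)) (Y(p := Pos)) = insert p (sep X Y)"
    by (auto simp: sep_def)
  have comp': "comp (X(p := Neg)) (Y(p := Pos)) h = comp X Y h" if "h \<noteq> p" for h
    using that by (simp add: comp_def)
  obtain d where d: "X d \<noteq> Zer" "Y d = Zer" using private_element[OF XY] .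
  obtain d' where d': "Y d' \<noteq> Zer" "X d' = Zer"
    using private_element[OF XY(2,1)] XY(3,4) vneg_eq_iff by metis
  \<comment> \<open>W does not vanish on both private elements, which fixes its sign.\<close>
  obtain b where b: "b \<notin> sep X Y" "W b = comp X Y b" "W b \<noteq> Zer" "b \<noteq> p"
  proof -
    have ds: "d \<notin> sep X Y" "d' \<notin> sep X Y" "d \<in> S" "d' \<in> S"
      using d d' by (auto simp: sep_def S_def supp_def)
    have "W d \<noteq> Zer \<or> W d' \<noteq> Zer"
    proof (rule ccontr)
      assume "\<not> ?thesis"
      then have z: "W d = Zer" "W d' = Zer" by auto
      then have "W = Y \<or> W = vneg Y"
        using pencil_common_zero[OF S W(1) WS XY(2) XS(2) ds(3)] d by blast
      then show False using z d' by auto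
    qed
    moreover have "W x \<noteq> Zer \<Longrightarrow> x \<noteq> p" for x using zp[OF W(1)] by auto
    ultimately show thesis using that W(4) ds by metis
  qed
  have pm: "Z = W \<or> Z = vneg W" if "Z \<in> C" "supp Z \<subseteq> S" "Z t = Zer" for Z
    using pencil_common_zero[OF S that(1,2) W(1) WS tS that(3) W(3)] .
  have lead': "\<sigma> Z = smult a (Z t)" if "Z \<in> C" "supp Z \<subseteq> S" "Z t \<noteq> Zer" for Z
    using lead that by (simp add: S_def)
  have off: "Z x = Zer" if "Z \<in> C" "supp Z \<subseteq> S" "x \<notin> S" for Z x
    using that by (auto simp: supp_def)
  \<comment> \<open>\<open>?Q\<close> is the predicate under \<open>THE\<close> in
    \<open>elim\<close>; what follows shows that exactly one vector satisfies it.\<close>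
  let ?Q = "\<lambda>Z. Z \<in> ext_cocircuits E C \<sigma> p \<and> Z p = Zer \<and>
      (\<forall>h. h \<notin> sep (X(p := Neg)) (Y(p := Pos)) \<longrightarrow> Z h = comp (X(p := Neg)) (Y(p := Pos)) h)"
  have Q: "?Q Z \<longleftrightarrow> (Z \<in> ext_cocircuits E C \<sigma> p \<and> Z p = Zer) \<and>
      (\<forall>h. h \<noteq> p \<longrightarrow> h \<notin> sep X Y \<longrightarrow> Z h = comp X Y h)" for Z
    unfolding sep' using comp' by auto
  have Qsupp: "supp Z \<subseteq> S" if "?Q Z" for Z
  proof
    fix x assume x: "x \<in> supp Z"
    then have "x \<noteq> p" using that by (auto simp: supp_def)
    then have "x \<in> sep X Y \<or> Z x = comp X Y x" using that Q by blast
    then show "x \<in> S" using x by (auto simp: supp_def sep_def comp_def S_def split: if_splits)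
  qed
  have Qb: "Z b = W b" if "?Q Z" for Z using that Q b by metis
  \<comment> \<open>An old candidate has localization 0, so it vanishes at \<open>t\<close> and is a
    multiple of \<open>W\<close>; the element \<open>b\<close> excludes
    \<open>vneg W\<close>.\<close>
  have old: "Z = W \<and> \<sigma> W = Zer" if "?Q Z" "Z \<in> C" "\<sigma> Z = Zer" for Z
  proof -
    have "Z t = Zer" using lead'[OF that(2) Qsupp[OF that(1)]] that(3) a by auto
    then have "Z = W \<or> Z = vneg W" using pm[OF that(2) Qsupp[OF that(1)]] by blast
    then have "Z = W" using Qb[OF that(1)] b(3) by auto
    then show ?thesis using that(3) by simp
  qed
  \<comment> \<open>Conformal cocircuits with opposite localizations cannot both be nonzero at
    \<open>t\<close>. The one that vanishes there is \<open>W\<close>, by its value at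
    \<open>b\<close>; the localization of the other one fixes its sign at \<open>t\<close>.\<close>
  have new: "\<exists>V\<in>C. supp V \<subseteq> S \<and> V t = sneg (smult a (\<sigma> W)) \<and> sep V W = {} \<and> Z = comp W V \<and> \<sigma> W \<noteq> Zer"
    if QZ: "?Q Z" and Y: "Z = comp Y1 Y2" "conformal Y1 Y2" "comodular E C Y1 Y2"
      "\<sigma> Y1 \<noteq> Zer" "\<sigma> Y1 = sneg (\<sigma> Y2)" for Z Y1 Y2
  proof -
    note Yc = comodular_cases[OF Y(3)]
    have Ys: "supp Y1 \<subseteq> S" "supp Y2 \<subseteq> S" using Qsupp[OF QZ] unfolding Y(1) supp_comp by auto
    have sp: "sep Y1 Y2 = {}" "sep Y2 Y1 = {}" using Y(2) sep_commute[of Y1 Y2] by (auto simp: conformal_def)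
    have com12: "comp Y1 Y2 = comp Y2 Y1" using comp_commute_off_sep[of _ Y1 Y2] sp by auto
    have key: ?thesis if "A \<in> C" "supp A \<subseteq> S" "B \<in> C" "supp B \<subseteq> S" "sep B A = {}" "Z = comp A B"
      "A \<noteq> B" "A \<noteq> vneg B" "A t = Zer" "\<sigma> A \<noteq> Zer" "\<sigma> B = sneg (\<sigma> A)" for A B
    proof -
      have "A = W \<or> A = vneg W" using pm[OF that(1,2,9)] .
      then have A: "A = W" using Qb[OF QZ] b(3) that(6) by (auto simp: comp_def split: if_splits)
      have Bt: "B t \<noteq> Zer"
      proof
        assume "B t = Zer"
        then have "A = B \<or> A = vneg B"
          using pencil_common_zero[OF S that(1,2,3,4) tS that(9)] by blast
        then show False using that(7,8) by blast
      qed
      have "sneg (\<sigma> W) = smult a (B t)" using lead'[OF that(3,4) Bt] that(11) A by simp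
      then have "B t = sneg (smult a (\<sigma> W))" using a by (cases a; cases "B t"; cases "\<sigma> W") auto
      then show ?thesis using that A by blast
    qed
    have "Y1 t = Zer \<or> Y2 t = Zer"
    proof (rule ccontr)
      assume "\<not> ?thesis"
      then have nz: "Y1 t \<noteq> Zer" "Y2 t \<noteq> Zer" by auto
      then have "smult a (Y1 t) = sneg (smult a (Y2 t))"
        using lead'[OF Yc(1) Ys(1)] lead'[OF Yc(2) Ys(2)] Y(5) by simp
      then have "Y1 t = sneg (Y2 t)" using a by (cases a; cases "Y1 t"; cases "Y2 t") auto
      then have "t \<in> sep Y1 Y2" using nz by (simp add: sep_def)
      then show False using sp by blast
    qed
    then show ?thesis
    proof
      assume z: "Y1 t = Zer"
      have "\<sigma> Y2 = sneg (\<sigma> Y1)" using Y(5) by simp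
      then show ?thesis by (rule key[OF Yc(1) Ys(1) Yc(2) Ys(2) sp(2) Y(1) Yc(3,4) z Y(4)])
    next
      have ne: "Y2 \<noteq> Y1" "Y2 \<noteq> vneg Y1" using Yc(3,4) by auto
      assume z: "Y2 t = Zer"
      have nz: "\<sigma> Y2 \<noteq> Zer" using Y(4,5) by (metis sneg.simps(3))
      have "Z = comp Y2 Y1" using Y(1) com12 by simp
      from key[OF Yc(2) Ys(2) Yc(1) Ys(1) sp(1) this ne z nz Y(5)] show ?thesis .
    qed
  qed
  have char: "(Z \<in> C \<and> \<sigma> Z = Zer) \<or> (\<exists>Y1 Y2. Z = comp Y1 Y2 \<and> conformal Y1 Y2 \<and> comodular E C Y1 Y2 \<and>
       \<sigma> Y1 \<noteq> Zer \<and> \<sigma> Y1 = sneg (\<sigma> Y2))" if "?Q Z" for Z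
    using that zero_cocircuits_of_ext[OF p] by blast
  show ?thesis
  proof (cases "\<sigma> W = Zer")
    case True
    \<comment> \<open>The assumption on \<open>W\<close> speaks only of its nonzero values. As
      \<sigma> vanishes on \<open>W\<close> but not on \<open>X\<close> and \<open>Y\<close>, these
      are no multiples of \<open>W\<close>, hence are nonzero at \<open>t\<close>, with opposite
      signs. So \<open>W\<close> is their elimination at \<open>t\<close>.\<close>
    have Wall: "W h = comp X Y h" if "h \<notin> sep X Y" for h
    proof (cases "W h = Zer")
      case Wh: True
      show ?thesis
      proof (cases "h \<in> S")
        case True
        have "W \<noteq> X" "W \<noteq> vneg X" "W \<noteq> Y" "W \<noteq> vneg Y" using \<sigma> \<open>\<sigma> W = Zer\<close> \<sigma>_vneg XY by auto
        then have "X h \<noteq> Zer" "Y h \<noteq> Zer"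
          using pencil_common_zero[OF S W(1) WS XY(1) XS(1) True Wh]
            pencil_common_zero[OF S W(1) WS XY(2) XS(2) True Wh] by blast+
        moreover have "X t \<noteq> Zer" "Y t \<noteq> Zer"
          using pm[OF XY(1) XS(1)] pm[OF XY(2) XS(2)]
            \<open>W \<noteq> X\<close> \<open>W \<noteq> vneg X\<close> \<open>W \<noteq> Y\<close> \<open>W \<noteq> vneg Y\<close> vneg_eq_iff by metis+
        moreover have "X t = sneg (Y t)"
          using lead'[OF XY(1) XS(1)] lead'[OF XY(2) XS(2)] \<sigma> calculation(3,4) a
          by (cases a; cases "X t"; cases "Y t") auto
        \<comment> \<open>W is the elimination of t between X and Y, so it is determined off the separation set.\<close>
        ultimately have "t \<in> sep X Y" by (simp add: sep_def)
        then obtain Z where Z: "Z \<in> C" "supp Z \<subseteq> S" "Z t = Zer" "\<And>h. h \<notin> sep X Y \<Longrightarrow> Z h = comp X Y h"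
          using pencil_elim_exists[OF S XY(1) XS(1) XY(2) XS(2) XY(3,4)] by metis
        then have "Z = W \<or> Z = vneg W" using pm by blast
        then have "Z = W" using Z(4)[OF b(1)] b by auto
        then show ?thesis using Z(4) that by blast
      next
        case False
        then show ?thesis using Wh off[OF XY(1) XS(1)] off[OF XY(2) XS(2)] by (simp add: comp_def)
      qed
    qed (use W(4) that in blast)
    have QW: "?Q W" unfolding Q using zero_cocircuits_of_ext[OF p, of W \<sigma>] W(1) True Wall by blast
    have "elim (insert p E) (ext_cocircuits E C \<sigma> p) (X(p := Neg)) (Y(p := Pos)) p = W"
      unfolding elim_def
    proof (rule the_equality)
      show "?Q W" by (rule QW)
      fix Z assume QZ: "?Q Z"
      show "Z = W" using char[OF QZ] old[OF QZ] new[OF QZ] True by blast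
    qed
    then show ?thesis using Wall True by auto
  next
    case False
    \<comment> \<open>\<open>U\<close> is the one of \<open>X\<close> and \<open>Y\<close> whose
      localization is opposite to that of \<open>W\<close>. It does not vanish at \<open>t\<close>:
      otherwise \<open>W\<close> would be a multiple of it, and a private element shows that
      \<open>W\<close> would have its localization.\<close>
    obtain U where U: "U \<in> C" "supp U \<subseteq> S" "U t = sneg (smult a (\<sigma> W))" "U = X \<or> U = Y"
    proof -
      have Xt: "X t = smult a Neg" if "X t \<noteq> Zer"
        using lead'[OF XY(1) XS(1) that] \<sigma> a by (cases a; cases "X t") auto
      have Yt: "Y t = a" if "Y t \<noteq> Zer"
        using lead'[OF XY(2) XS(2) that] \<sigma> a by (cases a; cases "Y t") auto
      have nb: "X t \<noteq> Zer \<or> Y t \<noteq> Zer"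
        using pencil_common_zero[OF S XY(1) XS(1) XY(2) XS(2) tS] XY(3,4) by blast
      have WX: "\<sigma> W = Neg" if "X t = Zer"
      proof -
        have eq: "W = X \<or> W = vneg X" using pm[OF XY(1) XS(1) that] by auto
        then have "W d \<noteq> Zer" using d by auto
        then have "W d = X d" using W(4)[of d] d by (auto simp: sep_def comp_def)
        then show ?thesis using eq d \<sigma> by auto
      qed
      have WY: "\<sigma> W = Pos" if "Y t = Zer"
      proof -
        have eq: "W = Y \<or> W = vneg Y" using pm[OF XY(2) XS(2) that] by auto
        then have "W d' \<noteq> Zer" using d' by auto
        then have "W d' = Y d'" using W(4)[of d'] d' by (auto simp: sep_def comp_def)
        then show ?thesis using eq d' \<sigma> by auto
      qed
      show thesis
      proof (cases "\<sigma> W")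
        case Pos
        then have "X t \<noteq> Zer" using WX by auto
        then show thesis using that[of X] Xt XY XS Pos a by (cases a) auto
      next
        case Neg
        then have "Y t \<noteq> Zer" using WY by auto
        then show thesis using that[of Y] Yt XY XS Neg a by (cases a) auto
      qed (use False in simp)
    qed
    have Ut: "U t \<noteq> Zer" using U(3) False a by simp
    obtain V where V: "V \<in> C" "supp V \<subseteq> S" "V t = U t" "sep V W = {}" "\<And>h. W h = Zer \<Longrightarrow> V h = U h"
      using pencil_conformal_exists[OF S W(1) WS W(3) U(1,2) Ut] by blast
    have Vt: "V t \<noteq> Zer" using V(3) Ut by simp
    have VW: "W \<noteq> V" "W \<noteq> vneg V" using Vt W(3) by auto
    \<comment> \<open>At a zero of \<open>W\<close> in \<open>S\<close> the neighbour
      \<open>V\<close> is nonzero and equals \<open>U\<close>; off \<open>sep X Y\<close> a nonzero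
      value of \<open>X\<close> or \<open>Y\<close> is the value of their composition.\<close>
    have all: "comp W V h = comp X Y h" if h: "h \<notin> sep X Y" for h
    proof (cases "W h = Zer")
      case True
      show ?thesis
      proof (cases "h \<in> S")
        case hS: True
        have "V h \<noteq> Zer"
          using pencil_common_zero[OF S W(1) WS V(1,2) hS True] VW by blast
        then have "U h \<noteq> Zer" using V(5)[OF True] by simp
        then have "U h = comp X Y h" using U(4) comp_eq_if_conform[OF h] by (auto simp: comp_def)
        then show ?thesis using V(5)[OF True] True by (simp add: comp_def)
      next
        case False
        then show ?thesis using off[OF XY(1) XS(1)] off[OF XY(2) XS(2)] off[OF V(1,2)] True
          by (simp add: comp_def)
      qed
    next
      case False
      then show ?thesis using W(4)[OF h] by (simp add: comp_def)
    qed
    have comWV: "comodular E C W V"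
      using comodular_pencil_members[OF com W(1) V(1) _ _ VW] WS V(2) by (simp add: S_def)
    have conf: "conformal W V" using V(4) sep_commute[of W V] by (simp add: conformal_def)
    have "\<sigma> V = sneg (\<sigma> W)" using lead'[OF V(1,2) Vt] V(3) U(3) a by (cases a; cases "\<sigma> W") auto
    then have "\<sigma> W = sneg (\<sigma> V)" by simp
    then have QZ: "?Q (comp W V)" unfolding Q
      using zero_cocircuits_of_ext[OF p, of "comp W V" \<sigma>] comWV conf False all by blast
    have "elim (insert p E) (ext_cocircuits E C \<sigma> p) (X(p := Neg)) (Y(p := Pos)) p = comp W V"
      unfolding elim_def
    proof (rule the_equality)
      show "?Q (comp W V)" by (rule QZ)
      fix Z assume QZ': "?Q Z"
      then have "\<exists>V\<in>C. supp V \<subseteq> S \<and> V t = sneg (smult a (\<sigma> W)) \<and> sep V W = {} \<and> Z = comp W V"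
        using char[OF QZ'] old[OF QZ'] new[OF QZ'] False by blast
      then obtain V' where V': "V' \<in> C" "supp V' \<subseteq> S" "V' t = sneg (smult a (\<sigma> W))" "sep V' W = {}"
        "Z = comp W V'" by blast
      have "V t = V' t" using V(3) U(3) V'(3) by simp
      then have "V = V'"
        using pencil_conformal_unique[OF S tS W(1) WS W(3) V(1,2,4) V'(1,2,4) _ Vt] by blast
      then show "Z = comp W V" using V'(5) by simp
    qed
    then show ?thesis using all False V U(3) unfolding S_def
      by (intro exI[of _ "comp W V"]) (auto simp: comp_def)
  qed
qed

end

section \<open>Closed walks and the rank of an extension\<close>

text \<open>The property behind \<open>elim\<close> as a relation: it passes to negatives and to
  exchanged arguments without an appeal to uniqueness.\<close>

definition is_elim :: "'a signvec set \<Rightarrow> 'a signvec \<Rightarrow> 'a signvec \<Rightarrow> 'a \<Rightarrow> 'a signvec \<Rightarrow> bool" where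
  "is_elim C X Y e Z \<longleftrightarrow> Z \<in> C \<and> Z e = Zer \<and> (\<forall>h. h \<notin> sep X Y \<longrightarrow> Z h = comp X Y h)"

lemma is_elim_commute: "is_elim C X Y e Z \<Longrightarrow> is_elim C Y X e Z"
  unfolding is_elim_def sep_commute[of X Y] using comp_commute_off_sep[of _ Y X] by auto

lemma sep_vneg [simp]: "sep (vneg X) (vneg Y) = sep X Y"
proof -
  have "sneg a = sneg (sneg b) \<longleftrightarrow> a = sneg b" for a b by (cases a; cases b) auto
  then show ?thesis by (simp add: sep_def del: sneg_sneg)
qed

lemma comp_vneg: "comp (vneg X) (vneg Y) = vneg (comp X Y)"
  by (auto simp: comp_def)

lemma conformal_commute: "conformal X Y \<longleftrightarrow> conformal Y X"
  by (simp add: conformal_def sep_commute)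

lemma conformal_vneg [simp]: "conformal (vneg X) (vneg Y) \<longleftrightarrow> conformal X Y"
  by (simp add: conformal_def)

text \<open>Stated for any order, as it serves both for numerical ranks of signs and for truth
  values ordered by implication.\<close>

lemma monotone_on_closed_walk_constant:
  fixes g :: "nat \<Rightarrow> 'b :: order"
  assumes step: "\<And>j. j < m \<Longrightarrow> g j \<le> g (Suc j)" and closed: "g m = g 0" and j: "j \<le> m"
  shows "g j = g 0"
proof (rule antisym)
  have mono: "i \<le> k \<Longrightarrow> k \<le> m \<Longrightarrow> g i \<le> g k" for i k
  proof (induction k rule: nat_induct)
    case (Suc k)
    then show ?case using step[of k] by (cases "i = Suc k") (auto intro: order_trans)
  qed simp
  show "g 0 \<le> g j" using mono[of 0 j] j by simp
  show "g j \<le> g 0" using mono[of j m] j closed by simp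
qed

context om
begin

lemma is_elim_vneg: "is_elim C X Y e Z \<Longrightarrow> is_elim C (vneg X) (vneg Y) e (vneg Z)"
  unfolding is_elim_def using vneg_in by (simp add: comp_vneg)

lemma comodular_commute: "comodular E C X Y \<Longrightarrow> comodular E C Y X"
  using comodular_pencil_members[of X Y Y X] comodular_cases[of X Y] vneg_eq_iff[of X Y] by auto

lemma comodular_vneg_left: "comodular E C X Y \<Longrightarrow> comodular E C (vneg X) Y"
  using comodular_pencil_members[of X Y "vneg X" Y] comodular_cases[of X Y] vneg_in[of X]
    vneg_eq_iff[of X Y] vneg_eq_iff[of X "vneg Y"]
  by auto

lemma comodular_vneg_both: "comodular E C X Y \<Longrightarrow> comodular E C (vneg X) (vneg Y)"
  using comodular_vneg_left comodular_commute by blast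

section \<open>Closed walks in the cocircuit graph of a Euclidean oriented matroid\<close>

text \<open>The Euclidean hypothesis speaks only of programs. If \<open>f\<close> were a coloop,
  there would be a cocircuit with support \<open>{f}\<close>, and every cocircuit nonzero at
  \<open>f\<close> would be a multiple of it. As \<open>W\<close> is one, that cocircuit vanishes at
  \<open>t\<close>; so \<open>X\<close> and \<open>Y\<close> vanish at \<open>f\<close>, and then so
  does \<open>W\<close>.\<close>

lemma is_program_of_elim:
  assumes com: "comodular E C X Y" and el: "is_elim C X Y t W" and f: "W f \<noteq> Zer"
    and t: "X t \<noteq> Zer" "Y t \<noteq> Zer"
  shows "is_program E C t f"
proof -
  note XY = comodular_cases[OF com]
  have W: "W \<in> C" "W t = Zer" "\<And>h. h \<notin> sep X Y \<Longrightarrow> W h = comp X Y h"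
    using el by (auto simp: is_elim_def)
  have tE: "t \<in> E" using cocircuit_zero_off_support[OF XY(1)] t by blast
  have fE: "f \<in> E" using cocircuit_zero_off_support[OF W(1)] f by blast
  have "separated {t}"
    unfolding separated_def using tE XY(1) t by (auto intro!: bexI[of _ X] simp: supp_def)
  then obtain B where "basis E C B" "t \<in> B"
    using separated_extends_to_basis[OF _ _ spanning_ground, of "{t}"] tE by auto
  then have "\<not> is_loop E C t" by (auto simp: is_loop_def)
  moreover have "\<not> is_coloop E C f"
  proof
    assume col: "is_coloop E C f"
    have "\<not> spanning E C (E - {f})"
    proof
      assume sp: "spanning E C (E - {f})"
      have "separated {}" by (simp add: separated_def)
      then obtain B where "basis E C B" "B \<subseteq> E - {f}"
        using separated_extends_to_basis[OF _ _ sp, of "{}"] by auto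
      then show False using col by (auto simp: is_coloop_def)
    qed
    then obtain D where D: "D \<in> C" "supp D \<subseteq> {f}"
      using supp_subset unfolding spanning_def by blast
    have DZ: "Z = D \<or> Z = vneg D" if "Z \<in> C" "Z f \<noteq> Zer" for Z
    proof -
      have "supp D \<subseteq> supp Z" using D that by (auto simp: supp_def)
      then show ?thesis using supp_incomparable[OF D(1) that(1)] vneg_eq_iff by auto
    qed
    have "W = D \<or> W = vneg D" using DZ[OF W(1) f] .
    then have ft: "D t = Zer" using W(2) by auto
    have "X f = Zer" using DZ[OF XY(1)] t(1) ft by (metis vneg_apply sneg.simps(3))
    moreover have "Y f = Zer" using DZ[OF XY(2)] t(2) ft by (metis vneg_apply sneg.simps(3))
    ultimately have "comp X Y f = Zer" "f \<notin> sep X Y" by (auto simp: comp_def sep_def)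
    then show False using W(3)[of f] f by simp
  qed
  moreover have "t \<noteq> f" using W(2) f by auto
  ultimately show ?thesis using tE fE by (simp add: is_program_def)
qed

lemma no_increasing_closed_walk:
  assumes euc: "euclidean_OM E C"
    and closed: "Q m = Q 0" "inj_on Q {0..<m}"
    and edges: "\<And>j. j < m \<Longrightarrow> comodular E C (Q j) (Q (Suc j))"
      "\<And>j. j < m \<Longrightarrow> conformal (Q j) (Q (Suc j))"
    and el: "\<And>j. j < m \<Longrightarrow> is_elim C (vneg (Q j)) (Q (Suc j)) t (W j)"
    and t: "\<And>j. j \<le> m \<Longrightarrow> Q j t = Pos"
    and f: "\<And>j. j < m \<Longrightarrow> W j f = Zer \<or> W j f = Pos" "\<exists>j<m. W j f = Pos"
  shows False
proof -
  have prog: "is_program E C t f"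
  proof -
    obtain j where j: "j < m" "W j f = Pos" using f(2) by blast
    show ?thesis
      using is_program_of_elim[OF comodular_vneg_left[OF edges(1)[OF j(1)]] el[OF j(1)]]
        j t[of j] t[of "Suc j"] by simp
  qed
  have "elim E C (vneg (Q j)) (Q (Suc j)) t = W j" if j: "j < m" for j
    using elim_eqI[OF comodular_vneg_left[OF edges(1)[OF j]], of t "W j"] el[OF j] t[of j] t[of "Suc j"] j
    by (auto simp: is_elim_def sep_def)
  then have "directed_cycle E C t f m Q"
    unfolding directed_cycle_def graph_edge_def arrow_def undirected_def
    using closed edges f t comodular_cases[OF edges(1)] by auto
  then show False using euc prog unfolding euclidean_OM_def euclidean_program_def by blast
qed

text \<open>Traversing the walk backwards negates the eliminations. Step \<open>j\<close> of the
  reversed walk is the old edge number \<open>m - Suc j\<close>.\<close>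

lemma no_decreasing_closed_walk:
  assumes euc: "euclidean_OM E C"
    and closed: "Q m = Q 0" "inj_on Q {0..<m}"
    and edges: "\<And>j. j < m \<Longrightarrow> comodular E C (Q j) (Q (Suc j))"
      "\<And>j. j < m \<Longrightarrow> conformal (Q j) (Q (Suc j))"
    and el: "\<And>j. j < m \<Longrightarrow> is_elim C (vneg (Q j)) (Q (Suc j)) t (W j)"
    and t: "\<And>j. j \<le> m \<Longrightarrow> Q j t = Pos"
    and f: "\<And>j. j < m \<Longrightarrow> W j f = Zer \<or> W j f = Neg" "\<exists>j<m. W j f = Neg"
  shows False
proof (rule no_increasing_closed_walk[of "\<lambda>j. Q (m - j)" m t "\<lambda>j. vneg (W (m - Suc j))" f])
  have Suc: "m - j = Suc (m - Suc j)" if "j < m" for j using that by simp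
  show "inj_on (\<lambda>j. Q (m - j)) {0..<m}"
  proof (rule inj_onI)
    fix i j assume ij: "i \<in> {0..<m}" "j \<in> {0..<m}" "Q (m - i) = Q (m - j)"
    \<comment> \<open>The reversed walk starts at index \<open>m\<close>, outside the range where
      \<open>Q\<close> is injective; \<open>g\<close> replaces it by 0, where \<open>Q\<close> has
      the same value.\<close>
    define g where "g k = (if k = 0 then 0 else m - k)" for k
    have "Q (m - k) = Q (g k)" for k using closed(1) by (simp add: g_def)
    then have "Q (g i) = Q (g j)" using ij(3) by simp
    moreover have "g i \<in> {0..<m}" "g j \<in> {0..<m}" using ij by (auto simp: g_def)
    ultimately have "g i = g j" using closed(2) by (auto dest: inj_onD)
    then show "i = j" using ij(1,2) by (auto simp: g_def split: if_splits)
  qed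
  fix j assume j: "j < m"
  then have k: "m - Suc j < m" by simp
  show "comodular E C (Q (m - j)) (Q (m - Suc j))"
    using comodular_commute[OF edges(1)[OF k]] Suc[OF j] by simp
  show "conformal (Q (m - j)) (Q (m - Suc j))"
    using edges(2)[OF k] conformal_commute Suc[OF j] by metis
  show "is_elim C (vneg (Q (m - j))) (Q (m - Suc j)) t (vneg (W (m - Suc j)))"
    using is_elim_vneg[OF is_elim_commute[OF el[OF k]]] Suc[OF j] by simp
  show "vneg (W (m - Suc j)) f = Zer \<or> vneg (W (m - Suc j)) f = Pos"
    using f(1)[OF k] by auto
next
  obtain j where j: "j < m" "W j f = Neg" using f(2) by blast
  then show "\<exists>j<m. vneg (W (m - Suc j)) f = Pos"
    by (intro exI[of _ "m - Suc j"]) auto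
qed (use euc closed t in auto)

text \<open>The sign \<open>b\<close> decides between the increasing and the decreasing case; if
  \<open>t\<close> is negative on the walk, all cocircuits are negated first.\<close>

lemma no_monotone_closed_walk:
  assumes euc: "euclidean_OM E C"
    and closed: "Q m = Q 0" "inj_on Q {0..<m}"
    and edges: "\<And>j. j < m \<Longrightarrow> comodular E C (Q j) (Q (Suc j))"
      "\<And>j. j < m \<Longrightarrow> conformal (Q j) (Q (Suc j))"
    and el: "\<And>j. j < m \<Longrightarrow> is_elim C (vneg (Q j)) (Q (Suc j)) t (W j)"
    and t: "\<And>j. j \<le> m \<Longrightarrow> Q j t = s" "s \<noteq> Zer"
    and f: "\<And>j. j < m \<Longrightarrow> W j f = Zer \<or> W j f = b" "\<exists>j<m. W j f \<noteq> Zer"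
  shows False
proof -
  have *: False
    if closed: "Q m = Q 0" "inj_on Q {0..<m}"
    and edges: "\<And>j. j < m \<Longrightarrow> comodular E C (Q j) (Q (Suc j))"
      "\<And>j. j < m \<Longrightarrow> conformal (Q j) (Q (Suc j))"
    and el: "\<And>j. j < m \<Longrightarrow> is_elim C (vneg (Q j)) (Q (Suc j)) t (W j)"
    and t: "\<And>j. j \<le> m \<Longrightarrow> Q j t = Pos"
    and f: "\<And>j. j < m \<Longrightarrow> W j f = Zer \<or> W j f = b" "\<exists>j<m. W j f \<noteq> Zer" for Q W b
  proof (cases b)
    case Pos
    then show False
      using no_increasing_closed_walk[OF euc closed edges el t, of f] f by metis
  next
    case Neg
    then show False
      using no_decreasing_closed_walk[OF euc closed edges el t, of f] f by metis
  qed (use f in auto)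
  show False
  proof (cases s)
    case Pos
    then show False using *[OF closed edges el _ f] t by auto
  next
    case Neg
    have inj: "inj_on (\<lambda>j. vneg (Q j)) {0..<m}"
      using closed(2) unfolding inj_on_def by (metis vneg_vneg)
    have el': "is_elim C (vneg (vneg (Q j))) (vneg (Q (Suc j))) t (vneg (W j))" if "j < m" for j
      using is_elim_vneg[OF el[OF that]] .
    have f': "vneg (W j) f = Zer \<or> vneg (W j) f = sneg b" if "j < m" for j using f(1)[OF that] by auto
    have f'': "\<exists>j<m. vneg (W j) f \<noteq> Zer" using f(2) by auto
    show False
      using *[of "\<lambda>j. vneg (Q j)" "\<lambda>j. vneg (W j)" "sneg b", OF _ inj _ _ el' _ f' f'']
        closed(1) edges comodular_vneg_both t Neg by auto
  qed (use t in simp)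
qed

section \<open>Bases and rank of a single-element extension\<close>

text \<open>Outside \<open>p\<close>, every cocircuit of the extension contains the support of an
  old one, and every old one extends to a cocircuit of the extension.\<close>

lemma spanning_ext_iff:
  assumes p: "p \<notin> E" and S: "S \<subseteq> E"
  shows "spanning (insert p E) (ext_cocircuits E C \<sigma> p) S \<longleftrightarrow> spanning E C S"
proof
  assume sp: "spanning (insert p E) (ext_cocircuits E C \<sigma> p) S"
  show "spanning E C S"
    unfolding spanning_def
  proof (intro conjI ballI S)
    fix X assume X: "X \<in> C"
    then have "X(p := \<sigma> X) \<in> ext_cocircuits E C \<sigma> p" unfolding ext_cocircuits_def by blast
    then have "S \<inter> supp (X(p := \<sigma> X)) \<noteq> {}" using sp by (simp add: spanning_def)
    then show "S \<inter> supp X \<noteq> {}" using p S by (auto simp: supp_def split: if_splits)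
  qed
next
  assume sp: "spanning E C S"
  show "spanning (insert p E) (ext_cocircuits E C \<sigma> p) S"
    unfolding spanning_def
  proof (intro conjI ballI)
    show "S \<subseteq> insert p E" using S by blast
    fix Z assume "Z \<in> ext_cocircuits E C \<sigma> p"
    then obtain X where X: "X \<in> C" "\<And>h. h \<noteq> p \<Longrightarrow> X h \<noteq> Zer \<Longrightarrow> Z h \<noteq> Zer"
    proof -
      assume thesis: "\<And>X. X \<in> C \<Longrightarrow> (\<And>h. h \<noteq> p \<Longrightarrow> X h \<noteq> Zer \<Longrightarrow> Z h \<noteq> Zer) \<Longrightarrow> thesis"
      consider X where "X \<in> C" "Z = X(p := \<sigma> X)" | Y1 Y2 where "Y1 \<in> C" "Z = (comp Y1 Y2)(p := Zer)"
        using \<open>Z \<in> ext_cocircuits E C \<sigma> p\<close> unfolding ext_cocircuits_def by blast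
      then show thesis
        by cases (rule thesis, assumption, simp add: comp_def)+
    qed
    have "S \<inter> supp X \<noteq> {}" using sp X(1) by (simp add: spanning_def)
    then obtain x where x: "x \<in> S" "X x \<noteq> Zer" by (auto simp: supp_def)
    have "x \<noteq> p" using x(1) p S by auto
    then have "Z x \<noteq> Zer" using X(2) x(2) by simp
    then show "S \<inter> supp Z \<noteq> {}" using x(1) by (auto simp: supp_def)
  qed
qed

text \<open>If \<open>p\<close> is in \<open>B\<close>, the private cocircuit of another element
  \<open>e\<close> vanishes at \<open>p\<close>; it is old or a composition of two old ones, one of
  which contains \<open>e\<close>. Since \<open>B - {p}\<close> is not spanning, an old element can
  replace \<open>p\<close>, which bounds the size of \<open>B\<close>.\<close>

lemma basis_ext_minus_new:
  assumes p: "p \<notin> E" and B: "basis (insert p E) (ext_cocircuits E C \<sigma> p) B"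
  shows "separated (B - {p})" "card B \<le> mrank E C E"
proof -
  let ?C' = "ext_cocircuits E C \<sigma> p"
  have BE: "B \<subseteq> insert p E" using B by (simp add: basis_def spanning_def)
  have fin: "finite B" using BE finite_E finite_subset by auto
  have "separated (B - {p}) \<and> card B \<le> mrank E C E"
  proof (cases "p \<in> B")
    case False
    then have BE': "B \<subseteq> E" using BE by blast
    have "basis E C B"
      unfolding basis_def
    proof (intro conjI allI impI)
      show "spanning E C B" using B spanning_ext_iff[OF p BE', of \<sigma>] by (simp add: basis_def)
      fix B' assume B': "B' \<subset> B"
      then have "\<not> spanning (insert p E) ?C' B'" using B by (simp add: basis_def)
      then show "\<not> spanning E C B'" using spanning_ext_iff[OF p, of B' \<sigma>] B' BE' by auto
    qed
    then show ?thesis using basis_imp_separated card_basis False by simp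
  next
    case True
    have s: "separated (B - {p})"
      unfolding separated_def
    proof (intro conjI ballI)
      show "B - {p} \<subseteq> E" using BE by blast
      fix e assume e: "e \<in> B - {p}"
      have "\<not> spanning (insert p E) ?C' (B - {e})" using B e by (auto simp: basis_def)
      then obtain Z where Z: "Z \<in> ?C'" "(B - {e}) \<inter> supp Z = {}"
        using BE unfolding spanning_def by blast
      have "B \<inter> supp Z \<noteq> {}" using B Z(1) by (simp add: basis_def spanning_def)
      then have Be: "B \<inter> supp Z = {e}" using Z(2) by blast
      then have "Z p = Zer" using True e by (auto simp: supp_def)
      then consider "Z \<in> C" | Y1 Y2 where "Y1 \<in> C" "Y2 \<in> C" "Z = comp Y1 Y2"
        using zero_cocircuits_of_ext[OF p, of Z \<sigma>] Z(1) comodular_cases(1,2) by blast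
      then show "\<exists>X\<in>C. supp X \<inter> (B - {p}) = {e}"
      proof cases
        case 1
        then show ?thesis using Be e by (intro bexI[of _ Z]) auto
      next
        case 2
        have u: "B \<inter> (supp Y1 \<union> supp Y2) = {e}" using Be 2(3) by simp
        then have "e \<in> supp Y1 \<or> e \<in> supp Y2" by blast
        then show ?thesis
        proof
          assume "e \<in> supp Y1"
          then show ?thesis using u e 2 by (intro bexI[of _ Y1]) auto
        next
          assume "e \<in> supp Y2"
          then show ?thesis using u e 2 by (intro bexI[of _ Y2]) auto
        qed
      qed
    qed
    have "\<not> spanning (insert p E) ?C' (B - {p})" using B True by (auto simp: basis_def)
    then have "\<not> spanning E C (B - {p})" using spanning_ext_iff[OF p, of "B - {p}" \<sigma>] BE by blast
    then obtain X where X: "X \<in> C" "supp X \<inter> (B - {p}) = {}"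
      using BE unfolding spanning_def by blast
    obtain e where e: "e \<in> supp X" using supp_nonempty[OF X(1)] by blast
    have s': "separated (insert e (B - {p}))" using separated_insert[OF s X e] .
    have "e \<notin> B - {p}" using X(2) e by blast
    then have "card (insert e (B - {p})) = card B"
      using fin True by (simp add: card_Suc_Diff1 del: card_Diff_insert)
    moreover have "card (insert e (B - {p})) \<le> mrank E C E"
      using mrank_ge[OF s'] s' by (simp add: separated_def)
    ultimately show ?thesis using s by simp
  qed
  then show "separated (B - {p})" "card B \<le> mrank E C E" by auto
qed

lemma basis_ext_of_basis:
  assumes p: "p \<notin> E" and B: "basis E C B"
  shows "basis (insert p E) (ext_cocircuits E C \<sigma> p) B"
proof -
  have BE: "B \<subseteq> E" using B by (simp add: basis_def spanning_def)
  show ?thesis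
    unfolding basis_def
  proof (intro conjI allI impI)
    show "spanning (insert p E) (ext_cocircuits E C \<sigma> p) B"
      using B spanning_ext_iff[OF p BE, of \<sigma>] by (simp add: basis_def)
    fix B' assume B': "B' \<subset> B"
    then have "\<not> spanning E C B'" using B by (simp add: basis_def)
    then show "\<not> spanning (insert p E) (ext_cocircuits E C \<sigma> p) B'"
      using spanning_ext_iff[OF p, of B' \<sigma>] B' BE by auto
  qed
qed

lemma mrank_ext:
  assumes p: "p \<notin> E"
  shows "A \<subseteq> E \<Longrightarrow> mrank (insert p E) (ext_cocircuits E C \<sigma> p) A = mrank E C A"
    and "mrank (insert p E) (ext_cocircuits E C \<sigma> p) (insert p E) = mrank E C E"
proof -
  let ?E' = "insert p E" and ?C' = "ext_cocircuits E C \<sigma> p"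
  have sub: "separated J \<Longrightarrow> indep ?E' ?C' J" for J
    using basis_ext_of_basis[OF p, of _ \<sigma>] indep_iff_separated unfolding indep_def by blast
  show "mrank ?E' ?C' A = mrank E C A" if A: "A \<subseteq> E"
  proof -
    have "indep ?E' ?C' J \<longleftrightarrow> separated J" if J: "J \<subseteq> A" for J
    proof
      assume "indep ?E' ?C' J"
      then obtain B where "basis ?E' ?C' B" "J \<subseteq> B" unfolding indep_def by blast
      moreover have "p \<notin> J" using J A p by blast
      ultimately show "separated J"
        using separated_mono[OF basis_ext_minus_new(1)[OF p]] by blast
    qed (rule sub)
    then have "{J. J \<subseteq> A \<and> indep ?E' ?C' J} = {J. J \<subseteq> A \<and> indep E C J}"
      by (auto simp: indep_iff_separated)
    then show ?thesis by (simp add: mrank_def)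
  qed
  let ?F = "{J. J \<subseteq> ?E' \<and> indep ?E' ?C' J}"
  show "mrank ?E' ?C' ?E' = mrank E C E"
    unfolding mrank_def[of ?E']
  proof (rule Max_eqI)
    show "finite (card ` ?F)" using finite_E by (auto intro: finite_subset[of _ "Pow ?E'"])
    fix n assume "n \<in> card ` ?F"
    then obtain J B where J: "n = card J" "basis ?E' ?C' B" "J \<subseteq> B" unfolding indep_def by blast
    moreover have "finite B" using J(2) finite_E finite_subset[of B ?E']
      by (auto simp: basis_def spanning_def)
    ultimately show "n \<le> mrank E C E"
      using basis_ext_minus_new(2)[OF p J(2)] card_mono order_trans by metis
  next
    obtain J where "separated J" "J \<subseteq> E" "card J = mrank E C E" using mrank_attained by blast
    then show "mrank E C E \<in> card ` ?F" using sub[of J] by (intro image_eqI[of _ _ J]) auto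
  qed
qed

text \<open>As \<open>p\<close> is nonzero on both vertices, the zero set of the composition lies in
  \<open>E\<close>, where the ranks agree.\<close>

lemma comodular_of_ext:
  assumes p: "p \<notin> E" and XY: "X \<in> C" "Y \<in> C" "X \<noteq> vneg Y"
    and com: "comodular (insert p E) (ext_cocircuits E C \<sigma> p) (X(p := Pos)) (Y(p := Pos))"
  shows "comodular E C X Y"
proof -
  have "X \<noteq> Y" using com by (auto simp: comodular_def)
  moreover have "zset (insert p E) (comp (X(p := Pos)) (Y(p := Pos))) = zset E (comp X Y)"
    using p by (auto simp: zset_def comp_def)
  moreover have "zset E (comp X Y) \<subseteq> E" by (auto simp: zset_def)
  ultimately show ?thesis
    using com XY comp_in_covectors[OF XY(1,2)] mrank_ext[OF p]
    by (simp add: comodular_def is_edge_def)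
qed

end

section \<open>Lexicographic extensions\<close>

lemma obtain_first:
  assumes "i < n" "P i"
  obtains k where "k < (n :: nat)" "P k" "\<And>l. l < k \<Longrightarrow> \<not> P l"
proof
  show "P (LEAST k. P k)" "\<And>l. l < (LEAST k. P k) \<Longrightarrow> \<not> P l"
    using LeastI[of P, OF assms(2)] not_less_Least by auto
  show "(LEAST k. P k) < n" using Least_le[of P, OF assms(2)] assms(1) by simp
qed

lemma lex_index_eqI:
  assumes "i = length I \<or> i < length I \<and> Y (I ! i) \<noteq> Zer" "\<And>l. l < i \<Longrightarrow> Y (I ! l) = Zer"
  shows "lex_index I Y = i"
  unfolding lex_index_def
proof (rule Least_equality)
  show "i = length I \<or> i < length I \<and> Y (I ! i) \<noteq> Zer" by (rule assms(1))
  fix k assume "k = length I \<or> k < length I \<and> Y (I ! k) \<noteq> Zer"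
  then show "i \<le> k" using assms by (metis leI less_or_eq_imp_le)
qed

lemma lex_loc_leading:
  assumes "i < length I" "Y (I ! i) \<noteq> Zer" "\<And>l. l < i \<Longrightarrow> Y (I ! l) = Zer"
  shows "lex_loc I \<alpha> Y = smult (\<alpha> ! i) (Y (I ! i))"
  using lex_index_eqI[of i I Y] assms by (simp add: lex_loc_def)

lemma lex_loc_nonzeroE:
  assumes "lex_loc I \<alpha> Y \<noteq> Zer"
  obtains i where "i < length I" "Y (I ! i) \<noteq> Zer"
proof (rule ccontr)
  assume "\<not> thesis"
  then have "\<And>l. l < length I \<Longrightarrow> Y (I ! l) = Zer" using that by blast
  then have "lex_index I Y = length I" using lex_index_eqI by blast
  then show False using assms by (simp add: lex_loc_def)
qed

lemma lex_loc_vneg: "lex_loc I \<alpha> (vneg Y) = sneg (lex_loc I \<alpha> Y)"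
proof -
  have "lex_index I (vneg Y) = lex_index I Y" by (simp add: lex_index_def)
  moreover have "smult a (sneg b) = sneg (smult a b)" for a b by (cases a; cases b) auto
  ultimately show ?thesis by (simp add: lex_loc_def Let_def)
qed

locale lex_extension = om E C for E :: "'a set" and C :: "'a signvec set" +
  fixes I :: "'a list" and \<alpha> :: "sign list" and p :: 'a
  assumes new: "p \<notin> E" and len: "length \<alpha> = length I" and nonzero: "\<forall>a\<in>set \<alpha>. a \<noteq> Zer"
begin

abbreviation "\<sigma> \<equiv> lex_loc I \<alpha>"

text \<open>With \<open>S\<close> the complement of the flat of a pencil, \<open>I ! i\<close> is
  the first listed element outside the flat, so it decides the localization of all members not
  vanishing on it.\<close>

definition leading :: "'a set \<Rightarrow> nat \<Rightarrow> bool" where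
  "leading S i \<longleftrightarrow> i < length I \<and> I ! i \<in> S \<and> (\<forall>l<i. I ! l \<notin> S)"

lemma \<alpha>_nonzero: "i < length I \<Longrightarrow> \<alpha> ! i \<noteq> Zer"
  using nonzero len by simp

lemma leading_sign:
  assumes "leading S i" "supp Z \<subseteq> S" "Z (I ! i) \<noteq> Zer"
  shows "\<sigma> Z = smult (\<alpha> ! i) (Z (I ! i))"
proof (rule lex_loc_leading)
  show "i < length I" using assms by (simp add: leading_def)
  fix l assume "l < i"
  then have "I ! l \<notin> S" using assms by (simp add: leading_def)
  then show "Z (I ! l) = Zer" using assms(2) by (auto simp: supp_def)
qed (rule assms)

section \<open>Elimination of the lexicographic element along an edge\<close>

text \<open>The vector whose value at \<open>f\<close> orients the edge in the extended program,
  expressed through the old cocircuits; vertices carry \<open>Pos\<close> at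
  \<open>p\<close>.\<close>

definition elim_new :: "'a signvec \<Rightarrow> 'a signvec \<Rightarrow> 'a \<Rightarrow> sign" where
  "elim_new X Y = elim (insert p E) (lex_ext E C I \<alpha> p) (vneg (X(p := Pos))) (Y(p := Pos)) p"

lemma elim_new_properties:
  assumes com: "comodular E C X Y" and \<sigma>: "\<sigma> X = Pos" "\<sigma> Y = Pos"
    and i: "leading (supp X \<union> supp Y) i"
    and W: "W \<in> C" "supp W \<subseteq> supp X \<union> supp Y" "W (I ! i) = Zer"
      "\<And>h. h \<notin> sep (vneg X) Y \<Longrightarrow> W h \<noteq> Zer \<Longrightarrow> W h = comp (vneg X) Y h"
  shows "\<And>h. h \<in> E \<Longrightarrow> h \<notin> sep (vneg X) Y \<Longrightarrow> elim_new X Y h = comp (vneg X) Y h"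
    and "\<And>h. W h \<noteq> Zer \<Longrightarrow> elim_new X Y h = W h"
    and "\<sigma> W = Zer \<Longrightarrow> elim_new X Y = W"
    and "\<sigma> W \<noteq> Zer \<Longrightarrow> \<exists>V\<in>C. supp V \<subseteq> supp X \<union> supp Y \<and> V (I ! i) = sneg (smult (\<alpha> ! i) (\<sigma> W)) \<and>
       (\<forall>h. W h = Zer \<longrightarrow> elim_new X Y h = V h)"
proof -
  have il: "i < length I" "I ! i \<in> supp X \<union> supp Y" using i by (auto simp: leading_def)
  have nX: "vneg (X(p := Pos)) = (vneg X)(p := Neg)" by (auto simp: vneg_def)
  have "\<exists>Z. elim_new X Y = Z \<and>
    (\<forall>h\<in>E. h \<notin> sep (vneg X) Y \<longrightarrow> Z h = comp (vneg X) Y h) \<and>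
    (\<forall>h. W h \<noteq> Zer \<longrightarrow> Z h = W h) \<and>
    (\<sigma> W = Zer \<longrightarrow> Z = W) \<and>
    (\<sigma> W \<noteq> Zer \<longrightarrow> (\<exists>V\<in>C. supp V \<subseteq> supp (vneg X) \<union> supp Y \<and>
       V (I ! i) = sneg (smult (\<alpha> ! i) (\<sigma> W)) \<and> (\<forall>h. W h = Zer \<longrightarrow> Z h = V h)))"
    unfolding elim_new_def nX lex_ext_def
  proof (rule elim_new_element[OF new comodular_vneg_left[OF com]])
    show "\<And>Z. supp Z \<subseteq> supp (vneg X) \<union> supp Y \<Longrightarrow> Z (I ! i) \<noteq> Zer \<Longrightarrow> \<sigma> Z = smult (\<alpha> ! i) (Z (I ! i))"
      using leading_sign[OF i] by simp
    show "\<alpha> ! i \<noteq> Zer" using \<alpha>_nonzero il by simp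
    show "\<And>h. h \<notin> sep (vneg X) Y \<Longrightarrow> W h \<noteq> Zer \<Longrightarrow> W h = comp (vneg X) Y h" by (rule W(4))
    show "\<sigma> (vneg X) = Neg" using \<sigma>(1) by (simp add: lex_loc_vneg)
  qed (use il W \<sigma> lex_loc_vneg in auto)
  then show "\<And>h. h \<in> E \<Longrightarrow> h \<notin> sep (vneg X) Y \<Longrightarrow> elim_new X Y h = comp (vneg X) Y h"
    and "\<And>h. W h \<noteq> Zer \<Longrightarrow> elim_new X Y h = W h"
    and "\<sigma> W = Zer \<Longrightarrow> elim_new X Y = W"
    and "\<sigma> W \<noteq> Zer \<Longrightarrow> \<exists>V\<in>C. supp V \<subseteq> supp X \<union> supp Y \<and> V (I ! i) = sneg (smult (\<alpha> ! i) (\<sigma> W)) \<and>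
       (\<forall>h. W h = Zer \<longrightarrow> elim_new X Y h = V h)"
    by auto
qed

lemma leading_exists:
  assumes "\<sigma> X = Pos"
  obtains i where "leading (supp X \<union> supp Y) i"
proof -
  obtain i where "i < length I" "X (I ! i) \<noteq> Zer" using lex_loc_nonzeroE[of I \<alpha> X] assms by auto
  then obtain k where k: "k < length I" "I ! k \<in> supp X \<union> supp Y" "\<And>l. l < k \<Longrightarrow> I ! l \<notin> supp X \<union> supp Y"
    using obtain_first[of i "length I" "\<lambda>k. I ! k \<in> supp X \<union> supp Y"] by (auto simp: in_supp)
  then show thesis using that[of k] by (auto simp: leading_def)
qed

lemma leading_value:
  assumes "leading S i" "supp X \<subseteq> S" "\<sigma> X = Pos" "X (I ! i) \<noteq> Zer"
  shows "X (I ! i) = \<alpha> ! i"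
  using leading_sign[OF assms(1,2,4)] assms(3) by (cases "\<alpha> ! i"; cases "X (I ! i)") auto

text \<open>Positive localization forces both cocircuits to take the value
  \<open>\<alpha> ! i\<close> at \<open>I ! i\<close>, so this element separates
  \<open>vneg X\<close> from \<open>Y\<close>.\<close>

lemma elim_leading_exists:
  assumes com: "comodular E C X Y" and \<sigma>: "\<sigma> X = Pos" "\<sigma> Y = Pos"
    and i: "leading (supp X \<union> supp Y) i" and nz: "X (I ! i) \<noteq> Zer" "Y (I ! i) \<noteq> Zer"
  shows "\<exists>W. is_elim C (vneg X) Y (I ! i) W \<and> supp W \<subseteq> supp X \<union> supp Y"
proof -
  note c = comodular_cases[OF comodular_vneg_left[OF com]]
  have "I ! i \<in> sep (vneg X) Y"
    using leading_value[OF i _ \<sigma>(1) nz(1)] leading_value[OF i _ \<sigma>(2) nz(2)] nz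
    by (simp add: sep_def)
  then obtain W where "W \<in> C" "supp W \<subseteq> supp X \<union> supp Y" "W (I ! i) = Zer"
    "\<And>h. h \<notin> sep (vneg X) Y \<Longrightarrow> W h = comp (vneg X) Y h"
    using pencil_elim_exists[OF comodular_imp_pencil[OF com] c(1) _ c(2) _ c(3,4)]
    by (metis Un_upper1 Un_upper2 supp_vneg)
  then show ?thesis unfolding is_elim_def by blast
qed

lemma elim_new_off_sep:
  assumes com: "comodular E C X Y" and \<sigma>: "\<sigma> X = Pos" "\<sigma> Y = Pos"
    and h: "h \<in> E" "h \<notin> sep (vneg X) Y"
  shows "elim_new X Y h = comp (vneg X) Y h"
proof -
  note c = comodular_cases[OF com]
  obtain i where i: "leading (supp X \<union> supp Y) i" using leading_exists[OF \<sigma>(1)] .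
  consider "X (I ! i) = Zer" | "Y (I ! i) = Zer" | "X (I ! i) \<noteq> Zer" "Y (I ! i) \<noteq> Zer" by blast
  \<comment> \<open>The member of the pencil vanishing at \<open>I ! i\<close> is
    \<open>vneg X\<close>, \<open>Y\<close>, or the elimination of \<open>I ! i\<close> between
    them.\<close>
  then obtain W where "W \<in> C" "supp W \<subseteq> supp X \<union> supp Y" "W (I ! i) = Zer"
      "\<And>h. h \<notin> sep (vneg X) Y \<Longrightarrow> W h \<noteq> Zer \<Longrightarrow> W h = comp (vneg X) Y h"
  proof cases
    case 1
    then show thesis using that[of "vneg X"] vneg_in[OF c(1)] by (auto simp: comp_def)
  next
    case 2
    then show thesis using that[of Y] c(2) comp_eq_if_conform[of _ "vneg X" Y] by auto
  next
    case 3
    then show thesis using that elim_leading_exists[OF com \<sigma> i] by (auto simp: is_elim_def)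
  qed
  from elim_new_properties(1)[OF com \<sigma> i this] h show ?thesis by blast
qed

text \<open>Here \<open>Y\<close> itself is the member of the pencil on the hyperplane of
  \<open>I ! i\<close>, and the elimination of \<open>p\<close> is a perturbation of it.\<close>

lemma elim_new_entering:
  assumes com: "comodular E C X Y" and \<sigma>: "\<sigma> X = Pos" "\<sigma> Y = Pos"
    and i: "leading (supp X \<union> supp Y) i" "Y (I ! i) = Zer" and f: "Y f \<noteq> Zer"
  shows "elim_new X Y f = Y f"
proof (rule elim_new_properties(2)[OF com \<sigma> i(1) _ _ i(2) _ f])
  show "Y \<in> C" using comodular_cases[OF com] by blast
  show "\<And>h. h \<notin> sep (vneg X) Y \<Longrightarrow> Y h \<noteq> Zer \<Longrightarrow> Y h = comp (vneg X) Y h"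
    by (simp add: comp_eq_if_conform)
qed blast

text \<open>Mirror image of the entering case, with \<open>vneg X\<close> as the member on the
  hyperplane.\<close>

lemma elim_new_leaving:
  assumes com: "comodular E C X Y" and \<sigma>: "\<sigma> X = Pos" "\<sigma> Y = Pos"
    and i: "leading (supp X \<union> supp Y) i" "X (I ! i) = Zer" and f: "X f \<noteq> Zer"
  shows "elim_new X Y f = sneg (X f)"
proof -
  have "elim_new X Y f = vneg X f"
  proof (rule elim_new_properties(2)[OF com \<sigma> i(1), where W = "vneg X"])
    show "supp (vneg X) \<subseteq> supp X \<union> supp Y" by simp
    show "vneg X \<in> C" using comodular_cases[OF com] vneg_in by blast
    show "\<And>h. vneg X h \<noteq> Zer \<Longrightarrow> vneg X h = comp (vneg X) Y h" by (simp add: comp_def)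
  qed (use i(2) f in auto)
  then show ?thesis by simp
qed

text \<open>If \<open>W\<close> vanishes at \<open>f\<close>, then \<open>f\<close> is parallel to
  \<open>I ! i\<close> in the pencil. The value at \<open>f\<close> then comes from the neighbour
  \<open>V\<close> of \<open>W\<close>, and the localization of \<open>W\<close> decides whether
  \<open>V\<close> lies on the side of \<open>X\<close> or of \<open>vneg X\<close>.\<close>

lemma elim_new_elim:
  assumes com: "comodular E C X Y" and \<sigma>: "\<sigma> X = Pos" "\<sigma> Y = Pos"
    and i: "leading (supp X \<union> supp Y) i" and nz: "X (I ! i) \<noteq> Zer"
    and W: "is_elim C (vneg X) Y (I ! i) W" "supp W \<subseteq> supp X \<union> supp Y"
  shows "W f \<noteq> Zer \<Longrightarrow> elim_new X Y f = W f"
    and "W f = Zer \<Longrightarrow> X f \<noteq> Zer \<Longrightarrow> elim_new X Y f = sneg (smult (X f) (\<sigma> W))"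
proof -
  have W': "W \<in> C" "W (I ! i) = Zer" "\<And>h. h \<notin> sep (vneg X) Y \<Longrightarrow> W h = comp (vneg X) Y h"
    using W(1) by (auto simp: is_elim_def)
  note props = elim_new_properties[OF com \<sigma> i W'(1) W(2) W'(2) W'(3)]
  show "W f \<noteq> Zer \<Longrightarrow> elim_new X Y f = W f" by (rule props(2))
  assume f: "W f = Zer" "X f \<noteq> Zer"
  let ?S = "supp X \<union> supp Y"
  have t: "I ! i \<in> ?S" using i by (simp add: leading_def)
  note X = comodular_cases(1)[OF com]
  have Xt: "X (I ! i) = \<alpha> ! i" using leading_value[OF i _ \<sigma>(1) nz] by simp
  note par = pencil_parallel[OF comodular_imp_pencil[OF com] t W'(1) W(2) W'(2) f(1)]
  show "elim_new X Y f = sneg (smult (X f) (\<sigma> W))"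
  proof (cases "\<sigma> W = Zer")
    case True
    then show ?thesis using props(3) f by (cases "X f") auto
  next
    case False
    then obtain V where V: "V \<in> C" "supp V \<subseteq> ?S" "V (I ! i) = sneg (smult (\<alpha> ! i) (\<sigma> W))"
      "elim_new X Y f = V f"
      using props(4) f(1) by blast
    have Vt: "V (I ! i) \<noteq> Zer" using V(3) nz Xt False by simp
    show ?thesis
    proof (cases "\<sigma> W")
      case Pos
      then have "V (I ! i) = vneg X (I ! i)" using V(3) Xt by (cases "\<alpha> ! i") auto
      then have "V f = vneg X f" using par[OF vneg_in[OF X] _ _ V(1,2)] Vt f(2) by simp
      then show ?thesis using V(4) Pos by (cases "X f") auto
    next
      case Neg
      then have "V (I ! i) = X (I ! i)" using V(3) Xt by (cases "\<alpha> ! i") auto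
      then have "V f = X f" using par[OF X _ _ V(1,2)] Vt f(2) by simp
      then show ?thesis using V(4) Neg by (cases "X f") auto
    qed (use False in simp)
  qed
qed

section \<open>From the extended program back to the original oriented matroid\<close>

lemma vertex_decomposition:
  assumes "Z \<in> lex_ext E C I \<alpha> p" "Z p = Pos"
  shows "Z(p := Zer) \<in> C" "\<sigma> (Z(p := Zer)) = Pos"
proof -
  obtain X where X: "X \<in> C" "Z = X(p := \<sigma> X)"
    using assms unfolding lex_ext_def ext_cocircuits_def by auto
  then have "Z(p := Zer) = X" using cocircuit_zero_off_support[OF X(1) new] by auto
  moreover have "\<sigma> X = Pos" using assms(2) X(2) by simp
  ultimately show "Z(p := Zer) \<in> C" "\<sigma> (Z(p := Zer)) = Pos" using X(1) by auto
qed

lemma graph_edge_decomposition: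
  assumes edge: "graph_edge (insert p E) (lex_ext E C I \<alpha> p) p Z Z'"
  shows "conformal (Z(p := Zer)) (Z'(p := Zer))" "comodular E C (Z(p := Zer)) (Z'(p := Zer))"
proof -
  have Z: "Z \<in> lex_ext E C I \<alpha> p" "Z p = Pos" "Z' \<in> lex_ext E C I \<alpha> p" "Z' p = Pos"
    and cc: "conformal Z Z'" "comodular (insert p E) (lex_ext E C I \<alpha> p) Z Z'"
    using edge by (auto simp: graph_edge_def)
  note d = vertex_decomposition[OF Z(1,2)] vertex_decomposition[OF Z(3,4)]
  show "conformal (Z(p := Zer)) (Z'(p := Zer))"
    using cc(1) by (auto simp: conformal_def sep_def split: if_splits)
  have "(Z(p := Zer))(p := Pos) = Z" "(Z'(p := Zer))(p := Pos) = Z'" using Z by auto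
  \<comment> \<open>Both vectors have positive localization, so they cannot be opposite.\<close>
  moreover have "Z(p := Zer) \<noteq> vneg (Z'(p := Zer))"
    using d(2,4) lex_loc_vneg[of I \<alpha> "Z'(p := Zer)"] by auto
  ultimately show "comodular E C (Z(p := Zer)) (Z'(p := Zer))"
    using comodular_of_ext[OF new d(1,3), of "lex_loc I \<alpha>"] cc(2) by (simp add: lex_ext_def)
qed

theorem euclidean_program_new_element:
  assumes euc: "euclidean_OM E C" and fE: "f \<in> E"
  shows "euclidean_program (insert p E) (lex_ext E C I \<alpha> p) p f"
  unfolding euclidean_program_def
proof
  assume "\<exists>m P. directed_cycle (insert p E) (lex_ext E C I \<alpha> p) p f m P"
  then obtain m P where cyc: "P m = P 0" "inj_on P {0..<m}"
    and edge: "\<And>j. j < m \<Longrightarrow> graph_edge (insert p E) (lex_ext E C I \<alpha> p) p (P j) (P (Suc j))"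
    and dir: "\<And>j. j < m \<Longrightarrow> arrow (insert p E) (lex_ext E C I \<alpha> p) p f (P j) (P (Suc j)) \<or>
      undirected (insert p E) (lex_ext E C I \<alpha> p) p f (P j) (P (Suc j))"
    and strict: "\<exists>j<m. arrow (insert p E) (lex_ext E C I \<alpha> p) p f (P j) (P (Suc j))"
    unfolding directed_cycle_def by blast
  have m: "0 < m" using strict by auto
  have vert: "P j \<in> lex_ext E C I \<alpha> p \<and> P j p = Pos" if "j \<le> m" for j
  proof (cases "j < m")
    case True
    then show ?thesis using edge by (simp add: graph_edge_def)
  next
    case False
    then have "j = m" using that by simp
    then show ?thesis using edge[OF m] cyc(1) by (simp add: graph_edge_def)
  qed
  \<comment> \<open>\<open>Q\<close> is the cycle without its coordinate \<open>p\<close>; the value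
    of \<open>Z j\<close> at \<open>f\<close> is the direction of edge number
    \<open>j\<close>.\<close>
  define Q where "Q j = (P j)(p := Zer)" for j
  define Z where "Z j = elim_new (Q j) (Q (Suc j))" for j
  have PQ: "P j = (Q j)(p := Pos)" if "j \<le> m" for j using vert[OF that] by (auto simp: Q_def)
  have QC: "Q j \<in> C" "\<sigma> (Q j) = Pos" if "j \<le> m" for j
    using vertex_decomposition vert[OF that] by (auto simp: Q_def)
  have \<sigma>: "\<sigma> (Q j) = Pos" "\<sigma> (Q (Suc j)) = Pos" if "j < m" for j using QC that by auto
  have conf: "conformal (Q j) (Q (Suc j))" and com: "comodular E C (Q j) (Q (Suc j))" if "j < m" for j
    using graph_edge_decomposition[OF edge[OF that]] by (auto simp: Q_def)
  have Zf: "Z j f = Zer \<or> Z j f = Pos" if "j < m" for j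
    using dir[OF that] PQ[of j] PQ[of "Suc j"] that
    by (auto simp: arrow_def undirected_def Z_def elim_new_def)
  have Zstrict: "\<exists>j<m. Z j f = Pos"
  proof -
    obtain j where j: "j < m" "arrow (insert p E) (lex_ext E C I \<alpha> p) p f (P j) (P (Suc j))"
      using strict by blast
    then show ?thesis using PQ[of j] PQ[of "Suc j"]
      by (auto simp: arrow_def Z_def elim_new_def)
  qed
  have closed: "Q m = Q 0" using cyc(1) by (simp add: Q_def)
  have inj: "inj_on Q {0..<m}"
  proof (rule inj_onI)
    fix i j assume ij: "i \<in> {0..<m}" "j \<in> {0..<m}" "Q i = Q j"
    then have "P i = P j" using PQ by simp
    then show "i = j" using cyc(2) ij by (auto dest: inj_onD)
  qed
  have sepf: "f \<in> sep (vneg (Q j)) (Q (Suc j)) \<longleftrightarrow> Q j f \<noteq> Zer \<and> Q j f = Q (Suc j) f" for j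
    by (auto simp: sep_def)
  have Zoff: "Z j f = comp (vneg (Q j)) (Q (Suc j)) f" if "j < m" "\<not> (Q j f \<noteq> Zer \<and> Q j f = Q (Suc j) f)" for j
    using elim_new_off_sep[OF com[OF that(1)] \<sigma>[OF that(1)] fE] that(2) sepf unfolding Z_def by blast

  \<comment> \<open>The sign of f never decreases along the cycle, so it is constant.\<close>
  define rk :: "sign \<Rightarrow> int" where "rk s = (case s of Neg \<Rightarrow> -1 | Zer \<Rightarrow> 0 | Pos \<Rightarrow> 1)" for s
  have rk_inj: "a = b" if "rk a = rk b" for a b
    using that by (cases a; cases b) (auto simp: rk_def)
  \<comment> \<open>A drop in the sign of \<open>f\<close> puts \<open>f\<close> outside the
    separation set, where \<open>Z j\<close> is the composition and has the value \<open>Neg\<close>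
    at \<open>f\<close>, against the direction.\<close>
  have step: "rk (Q j f) \<le> rk (Q (Suc j) f)" if "j < m" for j
    using Zoff[OF that] Zf[OF that]
    by (cases "Q j f"; cases "Q (Suc j) f") (auto simp: rk_def comp_def)
  have fconst: "Q j f = Q 0 f" if "j \<le> m" for j
    by (rule rk_inj, rule monotone_on_closed_walk_constant[where g = "\<lambda>j. rk (Q j f)", OF step _ that])
      (simp_all add: closed)
  define s where "s = Q 0 f"
  have Qf: "Q j f = s" if "j \<le> m" for j using fconst[OF that] by (simp add: s_def)
  have s: "s \<noteq> Zer"
  proof
    assume "s = Zer"
    obtain j where j: "j < m" "Z j f = Pos" using Zstrict by blast
    then show False using Zoff[OF j(1)] Qf[of j] Qf[of "Suc j"] \<open>s = Zer\<close> by (simp add: comp_def)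
  qed

  obtain i where i: "i < length I" "\<exists>j\<le>m. Q j (I ! i) \<noteq> Zer" "\<And>l. l < i \<Longrightarrow> \<not> (\<exists>j\<le>m. Q j (I ! l) \<noteq> Zer)"
  proof -
    obtain i0 where "i0 < length I" "Q 0 (I ! i0) \<noteq> Zer"
      using lex_loc_nonzeroE[of I \<alpha> "Q 0"] QC(2)[of 0] by auto
    then show thesis
      using obtain_first[of i0 "length I" "\<lambda>i. \<exists>j\<le>m. Q j (I ! i) \<noteq> Zer"] that by blast
  qed
  define t where "t = I ! i"
  have lead: "leading (supp (Q j) \<union> supp (Q (Suc j))) i"
    if "j < m" "Q j t \<noteq> Zer \<or> Q (Suc j) t \<noteq> Zer" for j
    using that i by (auto simp: leading_def supp_def t_def)

  \<comment> \<open>All edges between the hyperplane of t and its complement have the same direction, away from or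
     towards the hyperplane, depending on the sign of f.\<close>
  have cross: "(s = Pos \<longrightarrow> Q j t = Zer \<longrightarrow> Q (Suc j) t = Zer) \<and> (s = Neg \<longrightarrow> Q (Suc j) t = Zer \<longrightarrow> Q j t = Zer)"
    if j: "j < m" for j
  proof (intro conjI impI; rule ccontr)
    assume *: "s = Pos" "Q j t = Zer" "Q (Suc j) t \<noteq> Zer"
    have "Q j f = Pos" using Qf[of j] j *(1) by simp
    then have "Z j f = Neg"
      using elim_new_leaving[OF com[OF j] \<sigma>[OF j] lead[OF j]] * unfolding Z_def t_def by simp
    then show False using Zf[OF j] by simp
  next
    assume *: "s = Neg" "Q (Suc j) t = Zer" "Q j t \<noteq> Zer"
    have "Q (Suc j) f = Neg" using Qf[of "Suc j"] j *(1) by simp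
    then have "Z j f = Neg"
      using elim_new_entering[OF com[OF j] \<sigma>[OF j] lead[OF j]] * unfolding Z_def t_def by simp
    then show False using Zf[OF j] by simp
  qed
  \<comment> \<open>By \<open>cross\<close>, vanishing at \<open>t\<close> can only be gained along
    the walk, or only be lost; as the walk is closed, neither happens.\<close>
  have tconst: "(Q j t = Zer) = (Q 0 t = Zer)" if j: "j \<le> m" for j
  proof (cases s)
    case Pos
    then have "(Q j t = Zer) \<le> (Q (Suc j) t = Zer)" if "j < m" for j using cross[OF that] by simp
    from monotone_on_closed_walk_constant[where g = "\<lambda>j. Q j t = Zer", OF this _ j]
    show ?thesis using closed by simp
  next
    case Neg
    then have "(Q j t \<noteq> Zer) \<le> (Q (Suc j) t \<noteq> Zer)" if "j < m" for j using cross[OF that] by auto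
    from monotone_on_closed_walk_constant[where g = "\<lambda>j. Q j t \<noteq> Zer", OF this _ j]
    show ?thesis using closed by simp
  qed (use s in simp)
  then have tnz: "Q j t \<noteq> Zer" if "j \<le> m" for j using i(2) that unfolding t_def by blast
  note lead' = lead[OF _ disjI1[OF tnz[OF less_imp_le]]]
  \<comment> \<open>The elements of \<open>I\<close> before \<open>t\<close> vanish on the whole
    walk, so \<open>t\<close> decides the positive localization of each vertex.\<close>
  have tval: "Q j t = \<alpha> ! i" if j: "j \<le> m" for j
  proof -
    have "\<sigma> (Q j) = smult (\<alpha> ! i) (Q j (I ! i))"
      by (rule lex_loc_leading) (use i tnz[OF j] j in \<open>auto simp: t_def\<close>)
    then show ?thesis using QC(2)[OF j] unfolding t_def
      by (cases "\<alpha> ! i"; cases "Q j (I ! i)") auto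
  qed
  have \<alpha>i: "\<alpha> ! i \<noteq> Zer" using \<alpha>_nonzero i(1) .
  have "\<forall>j. \<exists>W. j < m \<longrightarrow> is_elim C (vneg (Q j)) (Q (Suc j)) t W \<and> supp W \<subseteq> supp (Q j) \<union> supp (Q (Suc j))"
    using elim_leading_exists[OF com \<sigma> lead'] tnz unfolding t_def by (metis Suc_leI less_imp_le)
  then obtain W where W: "\<And>j. j < m \<Longrightarrow> is_elim C (vneg (Q j)) (Q (Suc j)) t (W j)"
    "\<And>j. j < m \<Longrightarrow> supp (W j) \<subseteq> supp (Q j) \<union> supp (Q (Suc j))" by metis
  have ZW: "W j f \<noteq> Zer \<Longrightarrow> Z j f = W j f" "W j f = Zer \<Longrightarrow> Z j f = sneg (smult s (\<sigma> (W j)))"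
    if j: "j < m" for j
  proof -
    have nz: "Q j (I ! i) \<noteq> Zer" using tnz[of j] j by (simp add: t_def)
    note el = elim_new_elim[OF com[OF j] \<sigma>[OF j] lead'[OF j j] nz W(1)[OF j, unfolded t_def] W(2)[OF j], of f]
    show "W j f \<noteq> Zer \<Longrightarrow> Z j f = W j f" using el(1) by (simp add: Z_def)
    show "W j f = Zer \<Longrightarrow> Z j f = sneg (smult s (\<sigma> (W j)))"
      using el(2) Qf[of j] j s by (simp add: Z_def)
  qed
  have no_walk: False
    if "\<And>j. j < m \<Longrightarrow> W j x = Zer \<or> W j x = b" "\<exists>j<m. W j x \<noteq> Zer" for x b
    using no_monotone_closed_walk[OF euc closed inj com conf W(1) tval \<alpha>i that] .
  show False
  proof (cases "\<exists>j<m. W j f \<noteq> Zer")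
    case True
    \<comment> \<open>A nonzero value of \<open>W j\<close> at \<open>f\<close> is the value of
      \<open>Z j\<close>, so with \<open>t\<close> at infinity the walk is increasing for
      \<open>f\<close>.\<close>
    have "W j f = Zer \<or> W j f = Pos" if "j < m" for j
      using ZW(1)[OF that] Zf[OF that] by metis
    then show False using no_walk True by blast
  next
    case False
    \<comment> \<open>Now f is parallel to t on every edge; swapping the roles of t and p, the arrows are given by the
       localization of W j, which is decided lexicographically by the remaining elements of I.\<close>
    then have Zs: "Z j f = sneg (smult s (\<sigma> (W j)))" if "j < m" for j using ZW(2)[OF that] that by blast
    have \<sigma>W: "\<sigma> (W j) = Zer \<or> \<sigma> (W j) = sneg s" if "j < m" for j
      using Zs[OF that] Zf[OF that] s by (cases s; cases "\<sigma> (W j)") auto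
    obtain j0 where "j0 < m" "Z j0 f = Pos" using Zstrict by blast
    then have "\<sigma> (W j0) \<noteq> Zer" using Zs[of j0] s by (cases s) auto
    then obtain l0 where "l0 < length I" "W j0 (I ! l0) \<noteq> Zer" by (rule lex_loc_nonzeroE)
    then obtain l where l: "l < length I" "\<exists>j<m. W j (I ! l) \<noteq> Zer"
      "\<And>l'. l' < l \<Longrightarrow> \<not> (\<exists>j<m. W j (I ! l') \<noteq> Zer)"
      using obtain_first[of l0 "length I" "\<lambda>l. \<exists>j<m. W j (I ! l) \<noteq> Zer"] \<open>j0 < m\<close> by blast
    \<comment> \<open>The localizations of all \<open>W j\<close> are 0 or \<open>sneg s\<close>.
      When \<open>I ! l\<close> is nonzero on \<open>W j\<close> it decides this localization, so
      its sign is the same for all such \<open>j\<close> and the walk is monotone for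
      \<open>I ! l\<close>.\<close>
    have "W j (I ! l) = Zer \<or> W j (I ! l) = sneg (smult (\<alpha> ! l) s)" if j: "j < m" for j
    proof (cases "W j (I ! l) = Zer")
      case False
      have eq: "\<sigma> (W j) = smult (\<alpha> ! l) (W j (I ! l))"
        by (rule lex_loc_leading) (use l j False in auto)
      have al: "\<alpha> ! l \<noteq> Zer" using \<alpha>_nonzero l(1) .
      then have "\<sigma> (W j) \<noteq> Zer" using eq False by simp
      then have "smult (\<alpha> ! l) (W j (I ! l)) = sneg s" using \<sigma>W[OF j] eq by simp
      then show ?thesis using al False s by (cases "\<alpha> ! l"; cases "W j (I ! l)"; cases s) auto
    qed simp
    then show False using no_walk l(2) by blast
  qed
qed

end

theorem theorem1p1:
  fixes E :: "'a set" and C :: "'a signvec set" and I :: "'a list"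
    and \<alpha> :: "sign list" and p f :: 'a
  assumes "is_OM E C"
    and "euclidean_OM E C"
    and "p \<notin> E"
    and "distinct I" and "set I \<subseteq> E"
    and "length \<alpha> = length I" and "\<forall>a\<in>set \<alpha>. a \<noteq> Zer"
    and "\<not> is_loop (insert p E) (lex_ext E C I \<alpha> p) p"
    and "f \<in> E"
    and "\<not> is_coloop (insert p E) (lex_ext E C I \<alpha> p) f"
  shows "euclidean_program (insert p E) (lex_ext E C I \<alpha> p) p f"
proof -
  interpret lex_extension E C I \<alpha> p by unfold_locales (use assms in auto)
  show ?thesis using euclidean_program_new_element assms by blast
qed

end
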